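(* Let $(\bar x,\bar y)\in S^o_{\rm Lag}(\bar p)$, where $\bar p=(\bar w,0,0)$. Let $f_\nu:\mathbb R^n\times\mathbb R^d\to\mathbb R$ ($\nu=1,\dots,N$) and $F:\mathbb R^n\times\mathbb R^d\to\mathbb R^m$ be twice differentiable with respect to $x$ in a neighborhood of $(\bar x,\bar w)$, and suppose that $f_\nu$, $F$, $\nabla_xf_\nu$ and $\mathcal J_xF$ are strictly differentiable with respect to $(x,w)$ in this neighborhood. Then $S^o_{\rm Lag}$ has a Lipschitz continuous single-valued localization at $\bar p$ for $(\bar x,\bar y)$ if and only if, for every partition $\beta=\beta^+\cup\beta^0\cup\beta^-$ (parts disjoint, possibly empty), with $\alpha^+=\alpha\cup\beta^+$, the following implication holds for $w_1\in\mathbb R^n$, $[w_2]_{\alpha^+}\in\mathbb R^{|\alpha^+|}$, $[w_2]_{\beta^0}\in\mathbb R^{|\beta^0|}$: $$\left.\begin{array}{l}\mathbf G^Tw_1=\mathcal Jg_{\alpha^+}(\bar x)^T[w_2]_{\alpha^+}+\mathcal Jg_{\beta^0}(\bar x)^T[w_2]_{\beta^0}\\ \mathcal Jg_{\alpha^+}(\bar x)w_1=0,\ \mathcal Jg_{\beta^0}(\bar x)w_1\le0,\ [w_2]_{\beta^0}\ge0\end{array}\right\}\Longrightarrow w_1=0,\ [w_2]_{\alpha^+\cup\beta^0}=0.$$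
   Context: **Setting (shared equality and inequality constraints).** There are $N$ players, $n=n_1+\dots+n_N$, $x=(x^1,\dots,x^N)\in\mathbb R^n$ with $x^\nu\in\mathbb R^{n_\nu}$, and $x^{-\nu}$ denotes the other blocks. $K=\{0_q\}\times\mathbb R_-^{m-q}\subset\mathbb R^m$, with polar $K^\circ=\mathbb R^q\times\mathbb R_+^{m-q}$. Given $p=(w,v,u)\in\mathbb R^d\times\mathbb R^n\times\mathbb R^m$, player $\nu$ minimizes $f_\nu(x^\nu,x^{-\nu};w)-\langle v^\nu,x^\nu\rangle$ over $x^\nu\in\mathbb R^{n_\nu}$ subject to $F(x^\nu,x^{-\nu};w)-u\in K$. The set of consensus Lagrangian generalized Nash equilibria (common multiplier $y$) is $$S^o_{\rm Lag}(p)=\{(x,y)\in\mathbb R^n\times\mathbb R^m:\ \nabla_{x^\nu}f_\nu(x;w)+\mathcal J_{x^\nu}F(x;w)^Ty-v^\nu=0,\ \nu=1,\dots,N,\ \ 0\in-F(x;w)+u+N_{K^\circ}(y)\},$$ with $N_C$ the normal cone of convex analysis and $\mathcal J$ the Jacobian. **Notation.** Fix $\bar w\in\mathbb R^d$; $\theta_\nu=f_\nu(\cdot;\bar w)$, $g=F(\cdot;\bar w)$, $l_\nu(x,y)=\theta_\nu(x)+\langle y,g(x)\rangle$. $\mathbf G$ is the $n\times n$ matrix with $(\nu,\mu)$ block $\nabla^2_{x^\nu x^\mu}l_\nu(\bar x,\bar y)$ (derivative in $x^\mu$ of $\nabla_{x^\nu}l_\nu$). Index sets: $\alpha=\{1,\dots,q\}\cup\{i\in\{q+1,\dots,m\}:g_i(\bar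 x)=0<\bar y_i\}$, $\beta=\{i\in\{q+1,\dots,m\}:g_i(\bar x)=0=\bar y_i\}$. $g_I$ is the subvector of $g$ with indices in $I$. **Localization.** A set-valued $S$ has a Lipschitz continuous single-valued localization at $\bar a$ for $\bar b\in S(\bar a)$ if there are open neighborhoods $U$ of $\bar a$, $V$ of $\bar b$ and a single-valued Lipschitz continuous $s:U\to V$ with ${\rm gph}\,s={\rm gph}\,S\cap(U\times V)$. *)

theory Defs
  imports "HOL-Analysis.Analysis"
begin

text \<open>
  The block structure \<open>x = (x\<^sup>1, \<dots>, x\<^sup>N)\<close> of \<open>\<real>\<^sup>n\<close> is given by a map \<open>owner :: 'n \<Rightarrow> 'p\<close> from
  coordinates to players; block \<open>x\<^sup>\<nu>\<close> consists of the coordinates \<open>i\<close> with \<open>owner i = \<nu>\<close>, so that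
  \<open>n\<^sub>\<nu> = card {i. owner i = \<nu>}\<close>.  Likewise the \<open>q\<close> equality constraints among the \<open>m\<close> constraints
  are given by a set \<open>E :: 'm set\<close>, with \<open>q = card E\<close>, instead of by the first \<open>q\<close> indices.
\<close>

subsection \<open>Differentiability\<close>

definition grad :: "('a::real_inner \<Rightarrow> real) \<Rightarrow> 'a \<Rightarrow> 'a" where
  "grad h x = (THE D. GDERIV h x :> D)"

lemma grad_eqI:
  assumes "GDERIV h x :> D"
  shows "grad h x = D"
  unfolding grad_def
proof (rule the_equality)
  show "D' = D" if "GDERIV h x :> D'" for D'
  proof -
    have "(\<lambda>k. inner k D') = (\<lambda>k. inner k D)"
      by (rule has_derivative_unique[OF that[unfolded gderiv_def] assms[unfolded gderiv_def]])
    from fun_cong[OF this, of "D' - D"] have "inner (D' - D) (D' - D) = 0"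
      by (simp add: inner_diff_right)
    then show ?thesis
      by simp
  qed
qed (fact assms)

definition hessian :: "(real^'n \<Rightarrow> real) \<Rightarrow> real^'n \<Rightarrow> real^'n^'n" where
  "hessian h x = jacobian (grad h) (at x)"

definition twice_differentiable_at :: "('a::real_normed_vector \<Rightarrow> 'b::real_normed_vector) \<Rightarrow> 'a \<Rightarrow> bool" where
  "twice_differentiable_at h x \<longleftrightarrow>
     (\<exists>D :: 'a \<Rightarrow> ('a \<Rightarrow>\<^sub>L 'b).
        (\<forall>\<^sub>F z in nhds x. (h has_derivative blinfun_apply (D z)) (at z)) \<and>
        D differentiable (at x))"

definition strictly_differentiable_at :: "('a::real_normed_vector \<Rightarrow> 'b::real_normed_vector) \<Rightarrow> 'a \<Rightarrow> bool" where
  "strictly_differentiable_at h z \<longleftrightarrow>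
     (\<exists>A. bounded_linear A \<and>
        (\<forall>\<epsilon>>0. \<exists>\<delta>>0. \<forall>a\<in>ball z \<delta>. \<forall>b\<in>ball z \<delta>.
            norm (h a - h b - A (a - b)) \<le> \<epsilon> * norm (a - b)))"

subsection \<open>Polars, normal cones and single-valued localizations\<close>

definition polar :: "'a::real_inner set \<Rightarrow> 'a set" where
  "polar C = {y. \<forall>z\<in>C. inner y z \<le> 0}"

definition normal_cone :: "'a::real_inner set \<Rightarrow> 'a \<Rightarrow> 'a set" where
  "normal_cone C y = (if y \<in> C then {z. \<forall>c\<in>C. inner z (c - y) \<le> 0} else {})"

definition has_lipschitz_localization ::
    "('a::metric_space \<Rightarrow> 'b::metric_space set) \<Rightarrow> 'a \<Rightarrow> 'b \<Rightarrow> bool" where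
  "has_lipschitz_localization S a b \<longleftrightarrow>
     b \<in> S a \<and>
     (\<exists>U V s. open U \<and> a \<in> U \<and> open V \<and> b \<in> V \<and> s ` U \<subseteq> V \<and> (\<exists>L. L-lipschitz_on U s) \<and>
        {(p, z). p \<in> U \<and> z = s p} = {(p, z). z \<in> S p} \<inter> (U \<times> V))"

subsection \<open>The generalized Nash equilibrium problem\<close>

definition constraint_cone :: "'m set \<Rightarrow> (real^'m) set" where
  "constraint_cone E = {z. (\<forall>i\<in>E. z $ i = 0) \<and> (\<forall>i. i \<notin> E \<longrightarrow> z $ i \<le> 0)}"

lemma polar_constraint_cone: "polar (constraint_cone E) = {y. \<forall>i. i \<notin> E \<longrightarrow> 0 \<le> y $ i}"
proof (intro equalityI subsetI)
  fix y assume y: "y \<in> polar (constraint_cone E)"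
  have "0 \<le> y $ i" if "i \<notin> E" for i
  proof -
    have "axis i (-1) \<in> constraint_cone E"
      using that by (simp add: constraint_cone_def axis_def) blast
    with y have "inner y (axis i (-1)) \<le> 0"
      by (simp add: polar_def)
    then show ?thesis
      by (simp add: inner_axis)
  qed
  then show "y \<in> {y. \<forall>i. i \<notin> E \<longrightarrow> 0 \<le> y $ i}"
    by simp
next
  fix y :: "real^'a" assume y: "y \<in> {y. \<forall>i. i \<notin> E \<longrightarrow> 0 \<le> y $ i}"
  show "y \<in> polar (constraint_cone E)"
    unfolding polar_def constraint_cone_def inner_vec_def
  proof (intro CollectI ballI sum_nonpos)
    fix z :: "real^'a" and i
    assume "z \<in> {z. (\<forall>i\<in>E. z $ i = 0) \<and> (\<forall>i. i \<notin> E \<longrightarrow> z $ i \<le> 0)}"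
    then show "inner (y $ i) (z $ i) \<le> 0"
      using y by (cases "i \<in> E") (simp_all add: mult_nonneg_nonpos)
  qed
qed

text \<open>
  The partial gradient in the block \<open>x\<^sup>\<nu>\<close> is read off as the block \<open>\<nu>\<close> of the full gradient in \<open>x\<close>.
  Since \<open>grad\<close> and \<open>jacobian\<close> are total, the value of \<open>S_Lag\<close> is meaningful only where the data are
  differentiable in \<open>x\<close>; this is immaterial for localizations at a point near which they are.
\<close>

definition S_Lag ::
    "('n::finite \<Rightarrow> 'p) \<Rightarrow> 'm::finite set \<Rightarrow> ('p \<Rightarrow> (real^'n) \<times> (real^'d) \<Rightarrow> real) \<Rightarrow>
     ((real^'n) \<times> (real^'d) \<Rightarrow> real^'m) \<Rightarrow>
     (real^'d) \<times> (real^'n) \<times> (real^'m) \<Rightarrow> ((real^'n) \<times> (real^'m)) set" where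
  "S_Lag owner E f F = (\<lambda>(w, v, u). {(x, y).
     (\<forall>\<nu>. \<forall>i\<in>{i. owner i = \<nu>}.
        (grad (\<lambda>x'. f \<nu> (x', w)) x + transpose (jacobian (\<lambda>x'. F (x', w)) (at x)) *v y - v) $ i = 0) \<and>
     0 \<in> (\<lambda>z. - F (x, w) + u + z) ` normal_cone (polar (constraint_cone E)) y})"

definition lagrangian ::
    "('p \<Rightarrow> real^'n \<Rightarrow> real) \<Rightarrow> (real^'n \<Rightarrow> real^'m) \<Rightarrow> 'p \<Rightarrow> real^'n \<Rightarrow> real^'m \<Rightarrow> real" where
  "lagrangian \<theta> g \<nu> x y = \<theta> \<nu> x + inner y (g x)"

text \<open>
  Rows in block \<open>\<nu>\<close> come from the Hessian of player \<open>\<nu>\<close>'s own Lagrangian, so the matrix is in general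
  not symmetric.
\<close>

definition G_matrix ::
    "('n::finite \<Rightarrow> 'p) \<Rightarrow> ('p \<Rightarrow> real^'n \<Rightarrow> real) \<Rightarrow> (real^'n \<Rightarrow> real^'m) \<Rightarrow>
     real^'n \<Rightarrow> real^'m \<Rightarrow> real^'n^'n" where
  "G_matrix owner \<theta> g x y =
     (\<chi> i j. hessian (\<lambda>x'. lagrangian \<theta> g (owner i) x' y) x $ i $ j)"

definition alpha_set :: "'m set \<Rightarrow> (real^'n \<Rightarrow> real^'m) \<Rightarrow> real^'n \<Rightarrow> real^'m \<Rightarrow> 'm set" where
  "alpha_set E g x y = E \<union> {i. i \<notin> E \<and> g x $ i = 0 \<and> 0 < y $ i}"

definition beta_set :: "'m set \<Rightarrow> (real^'n \<Rightarrow> real^'m) \<Rightarrow> real^'n \<Rightarrow> real^'m \<Rightarrow> 'm set" where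
  "beta_set E g x y = {i. i \<notin> E \<and> g x $ i = 0 \<and> y $ i = 0}"

text \<open>
  \<open>\<J>g\<^sub>I(x)\<^sup>T [w]\<^sub>I\<close>: only the components of \<open>w\<close> with index in \<open>I\<close> enter, so subvectors \<open>[w]\<^sub>I\<close> need no
  type of their own.
\<close>

definition jacobian_transpose_on ::
    "'m::finite set \<Rightarrow> (real^'n \<Rightarrow> real^'m) \<Rightarrow> real^'n \<Rightarrow> real^'m \<Rightarrow> real^'n" where
  "jacobian_transpose_on I g x w = (\<Sum>i\<in>I. w $ i *\<^sub>R row i (jacobian g (at x)))"

end

theory Submission
  imports Defs
begin

text \<open>
  With \<open>t = y + F(x, w) - u\<close> and the projection \<open>P\<close> onto the polar cone, equilibria correspond to
  zeros of Robinson's normal map \<open>(\<nabla>f + JF\<^sup>T P(t), F - (t - P(t))) - (v, u)\<close>.  Near the reference point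
  \<open>P(t) - P(t') = d * (t - t')\<close> componentwise, where \<open>d\<close> is 1 on \<open>\<alpha>\<close>, arbitrary in \<open>[0,1]\<close> on
  \<open>\<beta>\<close> and 0 elsewhere, and every such \<open>d\<close> occurs.  By strict differentiability the normal map is
  therefore bounded below by a multiple of the distance if and only if each matrix
  \<open>(h, k) \<mapsto> (G h + A\<^sup>T (d * k), A h - (1 - d) * k)\<close> is nonsingular, and a lower bound together with
  invariance of domain yields the localization.  Transposing, a kernel vector for \<open>d\<close>
  satisfies \<open>d\<^sub>i (A w\<^sub>1)\<^sub>i = - (1 - d\<^sub>i) (w\<^sub>2)\<^sub>i\<close>; the sign conditions of the partition criterion lose
  half of these vectors, but cover up to sign all those for \<open>d\<close> with at most one fractional component.
  That suffices, as the determinant is affine in each \<open>d\<^sub>i\<close>.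
\<close>

text \<open>In \<open>y = P(y + F - u)\<close> the perturbation \<open>u\<close> sits inside the
  projection. The variable \<open>t\<close> moves it outside: \<open>(v, u)\<close> become values of
  a map, and a localization amounts to Lipschitz inversion of that map with \<open>w\<close> as a
  parameter. Differences of \<open>P\<close> are kept exactly in all estimates, so the only
  remainder comes from the smooth data. The weight \<open>d\<close> depends on the pair of points
  compared, so nonsingularity must be made uniform in \<open>d\<close>; compactness of the box of
  weights gives this. Since the normal map need not be differentiable, injectivity is taken from the
  lower bound and openness of the image from invariance of domain.

  The obstacle is in the linear algebra. The criterion asks for
  \<open>(A w1)_i <= 0 <= (w2)_i\<close> at all indices of \<open>\<beta>0\<close> at once, whereas
  a kernel vector for a weight with several fractional components may have different signs at
  different indices, and then neither it nor its negative is covered. With a single fractional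
  component there is only one sign to arrange.\<close>

subsection \<open>Strict derivatives\<close>

text \<open>Unlike \<open>strictly_differentiable_at\<close>, this names the derivative and replaces
  radii by the neighborhood filter of \<open>(z, z)\<close>, so that estimates combine by
  \<open>eventually_elim\<close> and are transported along \<open>filterlim\<close>.\<close>

definition has_strict_derivative ::
    "('a::real_normed_vector \<Rightarrow> 'b::real_normed_vector) \<Rightarrow> ('a \<Rightarrow> 'b) \<Rightarrow> 'a \<Rightarrow> bool" where
  "has_strict_derivative h A z \<longleftrightarrow> bounded_linear A \<and>
     (\<forall>\<epsilon>>0. \<forall>\<^sub>F p in nhds (z, z).
        norm (h (fst p) - h (snd p) - A (fst p - snd p)) \<le> \<epsilon> * norm (fst p - snd p))"

lemma has_strict_derivative_linear: "has_strict_derivative h A z \<Longrightarrow> bounded_linear A"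
  by (simp add: has_strict_derivative_def)

lemma has_strict_derivativeD:
  "has_strict_derivative h A z \<Longrightarrow> 0 < \<epsilon> \<Longrightarrow> \<forall>\<^sub>F p in nhds (z, z).
     norm (h (fst p) - h (snd p) - A (fst p - snd p)) \<le> \<epsilon> * norm (fst p - snd p)"
  by (simp add: has_strict_derivative_def)

lemma strictly_differentiable_at_imp:
  assumes "strictly_differentiable_at h z"
  obtains A where "has_strict_derivative h A z"
proof -
  obtain A where A: "bounded_linear A"
    and bound: "\<And>\<epsilon>. \<epsilon> > 0 \<Longrightarrow> \<exists>\<delta>>0. \<forall>a\<in>ball z \<delta>. \<forall>b\<in>ball z \<delta>.
            norm (h a - h b - A (a - b)) \<le> \<epsilon> * norm (a - b)"
    using assms unfolding strictly_differentiable_at_def by blast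
  have "\<forall>\<^sub>F p in nhds (z, z).
      norm (h (fst p) - h (snd p) - A (fst p - snd p)) \<le> \<epsilon> * norm (fst p - snd p)" if "\<epsilon> > 0" for \<epsilon>
  proof -
    obtain \<delta> where "\<delta> > 0" and \<delta>: "\<forall>a\<in>ball z \<delta>. \<forall>b\<in>ball z \<delta>.
            norm (h a - h b - A (a - b)) \<le> \<epsilon> * norm (a - b)"
      using bound[OF \<open>\<epsilon> > 0\<close>] by blast
    have "\<forall>\<^sub>F p in nhds (z, z). p \<in> ball z \<delta> \<times> ball z \<delta>"
      using \<open>\<delta> > 0\<close> by (intro eventually_nhds_in_open open_Times) auto
    then show ?thesis
      by eventually_elim (use \<delta> in auto)
  qed
  with A show thesis
    by (intro that[of A]) (simp add: has_strict_derivative_def)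
qed

lemma tendsto_fst_nhds: "(fst \<longlongrightarrow> a) (nhds (a, b))"
  and tendsto_snd_nhds: "(snd \<longlongrightarrow> b) (nhds (a, b))"
  by (auto intro!: tendsto_eq_intros filterlim_ident)

lemma filterlim_Pair_nhds_left: "filterlim (\<lambda>a. (a, z)) (nhds (z, z)) (nhds z)"
  by (intro tendsto_intros filterlim_ident)

lemma has_strict_derivative_imp_has_derivative:
  assumes "has_strict_derivative h A z"
  shows "(h has_derivative A) (at z)"
  unfolding has_derivative_at_alt
proof (intro conjI allI impI)
  show "bounded_linear A"
    using assms by (rule has_strict_derivative_linear)
  fix e :: real assume "0 < e"
  from filterlim_Pair_nhds_left[of z] has_strict_derivativeD[OF assms this]
  have "\<forall>\<^sub>F a in nhds z. norm (h a - h z - A (a - z)) \<le> e * norm (a - z)"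
    by (auto simp: filterlim_iff)
  then show "\<exists>d>0. \<forall>y. norm (y - z) < d \<longrightarrow> norm (h y - h z - A (y - z)) \<le> e * norm (y - z)"
    by (simp add: eventually_nhds_metric dist_norm)
qed

lemma has_strict_derivative_tendsto:
  "has_strict_derivative h A z \<Longrightarrow> (h \<longlongrightarrow> h z) (nhds z)"
  using has_derivative_continuous[OF has_strict_derivative_imp_has_derivative]
  by (metis continuous_within tendsto_at_iff_tendsto_nhds)

lemma has_strict_derivative_Lipschitz:
  assumes "has_strict_derivative h A z"
  obtains K where "K > 0" "\<forall>\<^sub>F p in nhds (z, z). norm (h (fst p) - h (snd p)) \<le> K * norm (fst p - snd p)"
proof -
  obtain K where K: "K > 0" "\<And>d. norm (A d) \<le> norm d * K"
    using bounded_linear.pos_bounded[OF has_strict_derivative_linear[OF assms]] by blast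
  show thesis
  proof (rule that[of "K + 1"])
    show "\<forall>\<^sub>F p in nhds (z, z). norm (h (fst p) - h (snd p)) \<le> (K + 1) * norm (fst p - snd p)"
      using has_strict_derivativeD[OF assms zero_less_one]
    proof eventually_elim
      case (elim p)
      show ?case
        using elim K(2)[of "fst p - snd p"]
          norm_triangle_ineq2[of "h (fst p) - h (snd p)" "A (fst p - snd p)"]
        by (simp add: algebra_simps)
    qed
  qed (use K in simp)
qed

section \<open>Calculus rules for strict derivatives\<close>

lemma bounded_linear_imp_has_strict_derivative:
  "bounded_linear A \<Longrightarrow> has_strict_derivative A A z"
  by (auto simp: has_strict_derivative_def linear_diff[OF bounded_linear.linear])

lemma has_strict_derivative_compose_linear:
  assumes L: "bounded_linear L" and h: "has_strict_derivative h A (L z)"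
  shows "has_strict_derivative (\<lambda>q. h (L q)) (\<lambda>d. A (L d)) z"
  unfolding has_strict_derivative_def
proof (intro conjI allI impI)
  show "bounded_linear (\<lambda>d. A (L d))"
    using has_strict_derivative_linear[OF h] L by (rule bounded_linear_compose)
  fix \<epsilon> :: real assume "\<epsilon> > 0"
  obtain K where K: "K > 0" "\<And>d. norm (L d) \<le> norm d * K"
    using bounded_linear.pos_bounded[OF L] by blast
  have "filterlim (\<lambda>p. (L (fst p), L (snd p))) (nhds (L z, L z)) (nhds (z, z))"
    by (intro tendsto_Pair bounded_linear.tendsto[OF L])
      (auto intro!: tendsto_eq_intros filterlim_ident)
  moreover have "\<forall>\<^sub>F p in nhds (L z, L z).
      norm (h (fst p) - h (snd p) - A (fst p - snd p)) \<le> \<epsilon> / K * norm (fst p - snd p)"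
    using \<open>\<epsilon> > 0\<close> K by (intro has_strict_derivativeD[OF h]) simp
  ultimately have "\<forall>\<^sub>F p in nhds (z, z). norm (h (L (fst p)) - h (L (snd p)) - A (L (fst p) - L (snd p)))
      \<le> \<epsilon> / K * norm (L (fst p) - L (snd p))"
    by (auto simp: filterlim_iff)
  then show "\<forall>\<^sub>F p in nhds (z, z). norm (h (L (fst p)) - h (L (snd p)) - A (L (fst p - snd p)))
      \<le> \<epsilon> * norm (fst p - snd p)"
  proof eventually_elim
    case (elim p)
    have "\<epsilon> / K * norm (L (fst p) - L (snd p)) \<le> \<epsilon> / K * (norm (fst p - snd p) * K)"
      using K(2)[of "fst p - snd p"] \<open>\<epsilon> > 0\<close> K(1)
      by (intro mult_left_mono) (simp_all add: linear_diff[OF bounded_linear.linear[OF L]])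
    then show ?case
      using elim K(1) by (simp add: linear_diff[OF bounded_linear.linear[OF L]])
  qed
qed

lemma has_strict_derivative_add:
  assumes "has_strict_derivative h A z" "has_strict_derivative k B z"
  shows "has_strict_derivative (\<lambda>q. h q + k q) (\<lambda>d. A d + B d) z"
  unfolding has_strict_derivative_def
proof (intro conjI allI impI)
  show "bounded_linear (\<lambda>d. A d + B d)"
    using assms by (intro bounded_linear_add has_strict_derivative_linear)
  fix \<epsilon> :: real assume "\<epsilon> > 0"
  then have "\<epsilon> / 2 > 0"
    by simp
  from assms[THEN has_strict_derivativeD, OF this]
  show "\<forall>\<^sub>F p in nhds (z, z). norm (h (fst p) + k (fst p) - (h (snd p) + k (snd p)) -
      (A (fst p - snd p) + B (fst p - snd p))) \<le> \<epsilon> * norm (fst p - snd p)"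
  proof eventually_elim
    case (elim p)
    then show ?case
      using norm_triangle_ineq[of "h (fst p) - h (snd p) - A (fst p - snd p)"
          "k (fst p) - k (snd p) - B (fst p - snd p)"]
      by (simp add: algebra_simps)
  qed
qed

lemma has_strict_derivative_Pair:
  assumes "has_strict_derivative h A z" "has_strict_derivative k B z"
  shows "has_strict_derivative (\<lambda>q. (h q, k q)) (\<lambda>d. (A d, B d)) z"
  unfolding has_strict_derivative_def
proof (intro conjI allI impI)
  show "bounded_linear (\<lambda>d. (A d, B d))"
    using assms by (intro bounded_linear_Pair has_strict_derivative_linear)
  fix \<epsilon> :: real assume "\<epsilon> > 0"
  then have "\<epsilon> / 2 > 0"
    by simp
  from assms[THEN has_strict_derivativeD, OF this]
  show "\<forall>\<^sub>F p in nhds (z, z). norm ((h (fst p), k (fst p)) - (h (snd p), k (snd p)) -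
      (A (fst p - snd p), B (fst p - snd p))) \<le> \<epsilon> * norm (fst p - snd p)"
  proof eventually_elim
    case (elim p)
    then show ?case
      using norm_Pair_le[of "h (fst p) - h (snd p) - A (fst p - snd p)"
          "k (fst p) - k (snd p) - B (fst p - snd p)"]
      by simp
  qed
qed

lemma has_strict_derivative_nth:
  fixes h :: "'a::real_normed_vector \<Rightarrow> real^'n"
  assumes "has_strict_derivative h A z"
  shows "has_strict_derivative (\<lambda>q. h q $ i) (\<lambda>d. A d $ i) z"
  unfolding has_strict_derivative_def
proof (intro conjI allI impI)
  show "bounded_linear (\<lambda>d. A d $ i)"
    by (rule bounded_linear_compose[OF bounded_linear_vec_nth has_strict_derivative_linear[OF assms]])
  fix \<epsilon> :: real assume "\<epsilon> > 0"
  from has_strict_derivativeD[OF assms this]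
  show "\<forall>\<^sub>F p in nhds (z, z).
      norm (h (fst p) $ i - h (snd p) $ i - A (fst p - snd p) $ i) \<le> \<epsilon> * norm (fst p - snd p)"
  proof eventually_elim
    case (elim p)
    then show ?case
      using component_le_norm_cart[of "h (fst p) - h (snd p) - A (fst p - snd p)" i] by simp
  qed
qed

lemma has_strict_derivative_vec:
  fixes h :: "'a::real_normed_vector \<Rightarrow> real^'n"
  assumes "\<And>i. has_strict_derivative (\<lambda>q. h q $ i) (\<lambda>d. A d $ i) z"
  shows "has_strict_derivative h A z"
  unfolding has_strict_derivative_def
proof (intro conjI allI impI)
  \<comment> \<open>Only the components of \<open>A\<close> are known to be bounded linear;
    \<open>A\<close> itself is reassembled along the standard basis.\<close>
  have "bounded_linear (\<lambda>d. A d $ i)" for i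
    using assms by (rule has_strict_derivative_linear)
  then have "bounded_linear (\<lambda>d. \<Sum>i\<in>UNIV. A d $ i *\<^sub>R axis i (1::real))"
    by (intro bounded_linear_sum bounded_linear_scaleR_left[THEN bounded_linear_compose])
  moreover have "(\<Sum>i\<in>UNIV. v $ i *\<^sub>R axis i (1::real)) = v" for v :: "real^'n"
    using basis_expansion[of v] by (simp add: scalar_mult_eq_scaleR)
  ultimately show "bounded_linear A"
    by simp
  fix \<epsilon> :: real assume "\<epsilon> > 0"
  then have "\<epsilon> / CARD('n) > 0"
    by simp
  from has_strict_derivativeD[OF assms this]
  have "\<forall>\<^sub>F p in nhds (z, z). \<forall>i. norm (h (fst p) $ i - h (snd p) $ i - A (fst p - snd p) $ i)
      \<le> \<epsilon> / CARD('n) * norm (fst p - snd p)"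
    by (intro eventually_all_finite) auto
  then show "\<forall>\<^sub>F p in nhds (z, z).
      norm (h (fst p) - h (snd p) - A (fst p - snd p)) \<le> \<epsilon> * norm (fst p - snd p)"
  proof eventually_elim
    case (elim p)
    have "norm (h (fst p) - h (snd p) - A (fst p - snd p))
        \<le> (\<Sum>i\<in>UNIV. \<bar>(h (fst p) - h (snd p) - A (fst p - snd p)) $ i\<bar>)"
      by (rule norm_le_l1_cart)
    also have "\<dots> \<le> (\<Sum>i\<in>(UNIV::'n set). \<epsilon> / CARD('n) * norm (fst p - snd p))"
      using elim by (intro sum_mono) simp
    finally show ?case
      by simp
  qed
qed

lemma has_strict_derivative_bilinear:
  assumes B: "bounded_bilinear B"
    and h: "has_strict_derivative h A z" and k: "has_strict_derivative k A' z"
  shows "has_strict_derivative (\<lambda>q. B (h q) (k q)) (\<lambda>d. B (h z) (A' d) + B (A d) (k z)) z"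
  unfolding has_strict_derivative_def
proof (intro conjI allI impI)
  interpret B: bounded_bilinear B by (rule B)
  note lin = has_strict_derivative_linear[OF h] has_strict_derivative_linear[OF k]
  show "bounded_linear (\<lambda>d. B (h z) (A' d) + B (A d) (k z))"
    using lin by (intro bounded_linear_add B.bounded_linear_left[THEN bounded_linear_compose]
        B.bounded_linear_right[THEN bounded_linear_compose])
  fix \<epsilon> :: real assume "\<epsilon> > 0"
  obtain K where K: "K > 0" "\<And>a b. norm (B a b) \<le> norm a * norm b * K"
    using B.pos_bounded by blast
  obtain L where L: "L > 0" "\<And>d. norm (A d) \<le> norm d * L"
    using bounded_linear.pos_bounded[OF lin(1)] by blast
  obtain L' where L': "L' > 0" "\<And>d. norm (A' d) \<le> norm d * L'"
    using bounded_linear.pos_bounded[OF lin(2)] by blast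
  \<comment> \<open>\<open>C\<close> collects the coefficients of the four error terms
    \<open>b1\<close> to \<open>b4\<close> below. The cap \<open>e \<le> 1\<close> allows
    \<open>norm (h a)\<close> and \<open>norm (k b)\<close> to be bounded by their values at
    \<open>z\<close> plus 1.\<close>
  define C where "C = K * ((norm (h z) + 1) + L' + (norm (k z) + 1) + L)"
  define e where "e = min 1 (\<epsilon> / C)"
  have "C > 0"
    using K L L' by (auto simp: C_def intro!: mult_pos_pos add_pos_pos add_nonneg_pos)
  then have e: "e > 0" "e \<le> 1" "C * e \<le> \<epsilon>"
    using \<open>\<epsilon> > 0\<close> by (auto simp: e_def min_def field_simps)
  have near: "\<forall>\<^sub>F p in nhds (z, z). norm (f (fst p) - f z) < e \<and> norm (f (snd p) - f z) < e"
    if "(f \<longlongrightarrow> f z) (nhds z)" for f :: "_ \<Rightarrow> 'x::real_normed_vector"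
  proof (rule eventually_conj)
    have lim: "filterlim fst (nhds z) (nhds (z, z))" "filterlim snd (nhds z) (nhds (z, z))"
      by (auto intro!: tendsto_eq_intros filterlim_ident)
    show "\<forall>\<^sub>F p in nhds (z, z). norm (f (fst p) - f z) < e"
      using tendstoD[OF filterlim_compose[OF that lim(1)] e(1)] by (simp add: dist_norm)
    show "\<forall>\<^sub>F p in nhds (z, z). norm (f (snd p) - f z) < e"
      using tendstoD[OF filterlim_compose[OF that lim(2)] e(1)] by (simp add: dist_norm)
  qed
  from has_strict_derivativeD[OF h e(1)] has_strict_derivativeD[OF k e(1)]
    near[OF has_strict_derivative_tendsto[OF h]] near[OF has_strict_derivative_tendsto[OF k]]
  show "\<forall>\<^sub>F p in nhds (z, z). norm (B (h (fst p)) (k (fst p)) - B (h (snd p)) (k (snd p)) -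
      (B (h z) (A' (fst p - snd p)) + B (A (fst p - snd p)) (k z))) \<le> \<epsilon> * norm (fst p - snd p)"
  proof eventually_elim
    case (elim p)
    define a where "a = fst p"
    define b where "b = snd p"
    define n where "n = norm (a - b)"
    have b1: "norm (B (h a) (k a - k b - A' (a - b))) \<le> (norm (h z) + 1) * (e * n) * K"
      using elim e(2) norm_triangle_ineq2[of "h a" "h z"] K(1)
      by (intro order_trans[OF K(2)] mult_right_mono mult_mono) (auto simp: a_def b_def n_def)
    have b2: "norm (B (h a - h z) (A' (a - b))) \<le> e * (n * L') * K"
      using elim K(1) L' e
      by (intro order_trans[OF K(2)] mult_right_mono mult_mono) (auto simp: a_def b_def n_def)
    have b3: "norm (B (h a - h b - A (a - b)) (k b)) \<le> (e * n) * (norm (k z) + 1) * K"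
      using elim e norm_triangle_ineq2[of "k b" "k z"] K(1)
      by (intro order_trans[OF K(2)] mult_right_mono mult_mono) (auto simp: a_def b_def n_def)
    have b4: "norm (B (A (a - b)) (k b - k z)) \<le> (n * L) * e * K"
      using elim K(1) L e
      by (intro order_trans[OF K(2)] mult_right_mono mult_mono) (auto simp: a_def b_def n_def)
    \<comment> \<open>One factor is changed at a time; then the increment is split into derivative
      and remainder, and the other factor is moved to \<open>z\<close>.\<close>
    have "B (h a) (k a) - B (h b) (k b) - (B (h z) (A' (a - b)) + B (A (a - b)) (k z)) =
        (B (h a) (k a - k b - A' (a - b)) + B (h a - h z) (A' (a - b))) +
        (B (h a - h b - A (a - b)) (k b) + B (A (a - b)) (k b - k z))"
      by (simp add: B.diff_left B.diff_right)
    also have "norm \<dots> \<le> (norm (h z) + 1) * (e * n) * K + e * (n * L') * K +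
        ((e * n) * (norm (k z) + 1) * K + (n * L) * e * K)"
      by (intro norm_triangle_le add_mono b1 b2 b3 b4)
    also have "\<dots> = C * e * n"
      by (simp add: C_def algebra_simps)
    also have "\<dots> \<le> \<epsilon> * n"
      using e(3) by (intro mult_right_mono) (auto simp: n_def)
    finally show ?case
      by (simp add: a_def b_def n_def)
  qed
qed

subsection \<open>Nonsingularity and the partition criterion\<close>

text \<open>Multilinearity of the determinant in row \<open>k\<close>; the updates of
  \<open>d\<close> leave all other rows as they are.\<close>

lemma det_row_affine:
  fixes a b :: "'k::finite \<Rightarrow> real^'k" and d :: "'k \<Rightarrow> real"
  shows "det (\<chi> i. (1 - d i) *\<^sub>R a i + d i *\<^sub>R b i) =
    (1 - d k) * det (\<chi> i. (1 - (d(k := 0)) i) *\<^sub>R a i + (d(k := 0)) i *\<^sub>R b i) +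
    d k * det (\<chi> i. (1 - (d(k := 1)) i) *\<^sub>R a i + (d(k := 1)) i *\<^sub>R b i)"
proof -
  let ?c = "\<lambda>i. (1 - d i) *\<^sub>R a i + d i *\<^sub>R b i"
  have "det (\<chi> i. ?c i) = det (\<chi> i. if i = k then (1 - d k) *s a i + d k *s b i else ?c i)"
    by (rule arg_cong[where f = det]) (simp add: vec_eq_iff algebra_simps)
  also have "\<dots> = (1 - d k) * det (\<chi> i. if i = k then a i else ?c i) +
      d k * det (\<chi> i. if i = k then b i else ?c i)"
    by (simp only: det_row_add[of k "\<lambda>i. (1 - d k) *s a i"] det_row_mul)
  also have "(\<chi> i. if i = k then a i else ?c i) =
      (\<chi> i. (1 - (d(k := 0)) i) *\<^sub>R a i + (d(k := 0)) i *\<^sub>R b i)"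
    by (simp add: vec_eq_iff)
  also have "(\<chi> i. if i = k then b i else ?c i) =
      (\<chi> i. (1 - (d(k := 1)) i) *\<^sub>R a i + (d(k := 1)) i *\<^sub>R b i)"
    by (simp add: vec_eq_iff)
  finally show ?thesis .
qed

text \<open>
  The determinant is affine in each weight, so nonvanishing on the edges of the cube of weights
  means that it has one sign at all vertices, hence on the whole cube.
\<close>

lemma det_row_combinations_nonzero:
  fixes a b :: "'k::finite \<Rightarrow> real^'k"
  assumes edge: "\<And>d k. (\<forall>i. 0 \<le> d i \<and> d i \<le> 1) \<Longrightarrow> (\<forall>i. i \<noteq> k \<longrightarrow> d i = 0 \<or> d i = 1) \<Longrightarrow>
      det (\<chi> i. (1 - d i) *\<^sub>R a i + d i *\<^sub>R b i) \<noteq> 0"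
    and d: "\<forall>i. 0 \<le> d i \<and> d i \<le> 1"
  shows "det (\<chi> i. (1 - d i) *\<^sub>R a i + d i *\<^sub>R b i) \<noteq> 0"
proof -
  define D where "D d = det (\<chi> i. (1 - d i) *\<^sub>R a i + d i *\<^sub>R b i)" for d
  have aff: "D d = (1 - d k) * D (d(k := 0)) + d k * D (d(k := 1))" for d k
    unfolding D_def by (rule det_row_affine)
  define \<sigma> where "\<sigma> = sgn (D (\<lambda>_. 0))"
  have flip: "0 < \<sigma> * D (d(k := 1))" if v: "\<forall>i. d i = 0 \<or> d i = 1" and dk: "d k = 0" and pos: "0 < \<sigma> * D d" for d k
  proof (rule ccontr)
    assume neg: "\<not> ?thesis"
    define p where "p = \<sigma> * D d"
    define r where "r = \<sigma> * D (d(k := 1))"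
    \<comment> \<open>The zero of the affine function that runs from \<open>p > 0\<close> to
      \<open>r \<le> 0\<close> along the edge in direction \<open>k\<close>; on an edge
      \<open>D\<close> must not vanish.\<close>
    define s where "s = p / (p - r)"
    have pr: "p > 0" "r \<le> 0"
      using pos neg by (auto simp: p_def r_def)
    then have s: "0 \<le> s" "s \<le> 1" "(1 - s) * p + s * r = 0"
      by (auto simp: s_def field_simps)
    have "d(k := 0) = d"
      using dk by auto
    then have "\<sigma> * D (d(k := s)) = (1 - s) * p + s * r"
      by (subst aff[of "d(k := s)" k]) (simp add: p_def r_def algebra_simps)
    then have "\<sigma> * D (d(k := s)) = 0"
      using s by simp
    moreover have "D (d(k := s)) \<noteq> 0"
      unfolding D_def using v s by (intro edge[of _ k]) (auto, metis order_refl zero_le_one, metis order_refl zero_le_one)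
    moreover have "\<sigma> \<noteq> 0"
      using pos by auto
    ultimately show False
      by simp
  qed
  \<comment> \<open>Every vertex is reached from the origin by switching one coordinate at a time,
    each switch running along an edge.\<close>
  have vertex: "0 < \<sigma> * D (\<lambda>i. if i \<in> I then 1 else 0)" if "finite I" for I
    using that
  proof (induction I rule: finite_induct)
    case empty
    have "D (\<lambda>_. 0) \<noteq> 0"
      unfolding D_def by (rule edge) auto
    then show ?case
      by (simp add: \<sigma>_def flip: abs_sgn)
         (simp add: sgn_mult_self_eq mult.commute flip: abs_sgn)
  next
    case (insert k I)
    have "(\<lambda>i. if i \<in> insert k I then 1 else 0) = (\<lambda>i. if i \<in> I then 1 else 0 :: real)(k := 1)"
      by auto
    then show ?case
      using flip[of "\<lambda>i. if i \<in> I then 1 else 0" k] insert by simp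
  qed
  \<comment> \<open>Induction on a set containing the fractional coordinates: \<open>D d\<close> is
    a convex combination of the values with coordinate \<open>k\<close> rounded to 0 and to
    1.\<close>
  have "0 < \<sigma> * D d" if "finite I" "\<forall>i. 0 \<le> d i \<and> d i \<le> 1" "\<forall>i. i \<notin> I \<longrightarrow> d i = 0 \<or> d i = 1" for I d
    using that
  proof (induction I arbitrary: d rule: finite_induct)
    case empty
    then have "d = (\<lambda>i. if i \<in> {i. d i = 1} then 1 else 0)"
      by (auto simp: fun_eq_iff)
    then show ?case
      using vertex[of "{i. d i = 1}"] by simp
  next
    case (insert k I)
    have pos: "0 < \<sigma> * D (d(k := 0))" "0 < \<sigma> * D (d(k := 1))"
      using insert.prems by (auto intro!: insert.IH; metis)+
    have "\<sigma> * D d = (1 - d k) * (\<sigma> * D (d(k := 0))) + d k * (\<sigma> * D (d(k := 1)))"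
      by (subst aff[of d k]) (simp add: algebra_simps)
    moreover have "0 \<le> d k" "d k \<le> 1"
      using insert.prems by auto
    moreover have "0 < (1 - s) * p + s * q" if "0 < p" "0 < q" "0 \<le> s" "s \<le> 1" for p q s :: real
      using that by (cases "s = 0") (auto intro!: add_nonneg_pos)
    ultimately show ?case
      using pos by metis
  qed
  from this[of UNIV d] d show ?thesis
    by (auto simp: D_def)
qed

lemma det_nonzero_iff_kernel:
  fixes N :: "real^'k^'k"
  shows "det N \<noteq> 0 \<longleftrightarrow> (\<forall>v. N *v v = 0 \<longrightarrow> v = 0)"
  by (metis invertible_det_nz invertible_left_inverse matrix_left_invertible_ker)

text \<open>
  Every component of an element of \<open>weights \<alpha> \<beta>\<close> is a difference quotient of the positive part
  (of the identity on equality components): near an index in \<open>\<alpha>\<close> the slope is 1, off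
  \<open>\<alpha> \<union> \<beta>\<close> it is 0, and on \<open>\<beta>\<close> any slope between the two occurs.
\<close>

definition weights :: "'m set \<Rightarrow> 'm set \<Rightarrow> (real^'m) set" where
  "weights \<alpha> \<beta> = cbox (\<chi> i. if i \<in> \<alpha> then 1 else 0) (\<chi> i. if i \<in> \<alpha> \<union> \<beta> then 1 else 0)"

lemma mem_weights_iff:
  "\<alpha> \<inter> \<beta> = {} \<Longrightarrow> d \<in> weights \<alpha> \<beta> \<longleftrightarrow>
    (\<forall>i. (i \<in> \<alpha> \<longrightarrow> d $ i = 1) \<and> (i \<in> \<beta> \<longrightarrow> 0 \<le> d $ i \<and> d $ i \<le> 1) \<and> (i \<notin> \<alpha> \<union> \<beta> \<longrightarrow> d $ i = 0))"
  by (simp add: weights_def mem_box_cart) (safe; force simp: disjoint_iff)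

text \<open>Indexing by a sum type makes the block operator on pairs a square matrix, to which
  \<open>det\<close> applies.\<close>

definition join_vec :: "real^'n \<Rightarrow> real^'m \<Rightarrow> real^('n + 'm)" where
  "join_vec a b = (\<chi> i. case i of Inl p \<Rightarrow> a $ p | Inr p \<Rightarrow> b $ p)"

lemma join_vec_nth [simp]: "join_vec a b $ Inl p = a $ p" "join_vec a b $ Inr r = b $ r"
  by (simp_all add: join_vec_def)

lemma join_vec_exhaust: obtains a b where "v = join_vec a b"
  by (rule that[of "\<chi> p. v $ Inl p" "\<chi> p. v $ Inr p"])
    (simp add: join_vec_def vec_eq_iff split: sum.split)

lemma join_vec_eq_0_iff [simp]: "join_vec a b = 0 \<longleftrightarrow> a = 0 \<and> b = 0"
  by (auto simp: vec_eq_iff join_vec_def split: sum.splits)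

lemma inner_join_vec [simp]:
  fixes a a' :: "real^'n" and b b' :: "real^'m"
  shows "inner (join_vec a b) (join_vec a' b') = inner a a' + inner b b'"
proof -
  have "inner (join_vec a b) (join_vec a' b') =
      (\<Sum>i\<in>UNIV <+> UNIV. inner (join_vec a b $ i) (join_vec a' b' $ i))"
    by (simp add: inner_vec_def)
  then show ?thesis
    by (subst (asm) sum.Plus) (simp_all add: inner_vec_def)
qed

lemma inner_vec_times_left: "inner (d * x) y = inner x (d * y)" for d x y :: "real^'m"
  by (simp add: inner_vec_def mult_ac)

text \<open>
  The rows are written as convex combinations with weights \<open>d\<close>, the form needed for
  \<open>det_row_combinations_nonzero\<close>.
\<close>

definition coderivative_matrix :: "real^'n^'n \<Rightarrow> real^'n^'m \<Rightarrow> real^'m \<Rightarrow> real^('n + 'm)^('n + 'm)" where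
  "coderivative_matrix G A d = (\<chi> i. case i of
       Inl p \<Rightarrow> join_vec (column p G) (column p A)
     | Inr p \<Rightarrow> (1 - d $ p) *\<^sub>R join_vec 0 (- axis p 1) + d $ p *\<^sub>R join_vec (row p A) 0)"

lemma coderivative_matrix_mult:
  "coderivative_matrix G A d *v join_vec a b =
     join_vec (transpose G *v a + transpose A *v b) (d * (A *v a) - (1 - d) * b)"
proof -
  have rows: "transpose M $ p = column p M" "row q M = M $ q" for M :: "real^'x^'y" and p q
    by (simp_all add: transpose_def column_def row_def vec_eq_iff)
  have "(coderivative_matrix G A d *v join_vec a b) $ i =
     join_vec (transpose G *v a + transpose A *v b) (d * (A *v a) - (1 - d) * b) $ i" for i
    by (cases i) (simp_all add: matrix_vector_mul_component coderivative_matrix_def inner_add_left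
        inner_axis' rows del: transpose_matrix_vector)
  then show ?thesis
    by (simp add: vec_eq_iff)
qed

text \<open>The transpose is the linearized normal map at fixed parameter, with \<open>d\<close> as
  slope of the projection. It is obtained from the adjoint identity instead of entry by entry.
  Nonsingularity is the same for both matrices, which links the normal map to the transposed system
  of the criterion.\<close>

lemma transpose_coderivative_matrix_mult:
  fixes G :: "real^'n^'n" and A :: "real^'n^'m"
  shows "transpose (coderivative_matrix G A d) *v join_vec h k =
    join_vec (G *v h + transpose A *v (d * k)) (A *v h - (1 - d) * k)"
proof (rule vector_eq_ldot[THEN iffD1], rule allI)
  have tr: "inner x (transpose M *v y) = inner (M *v x) y" for M :: "real^'x^'y" and x y
    by (metis dot_lmul_matrix inner_commute transpose_matrix_vector)
  fix x :: "real^('n + 'm)"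
  obtain a b where x: "x = join_vec a b"
    by (rule join_vec_exhaust)
  have t1: "inner (transpose G *v a) h = inner a (G *v h)" "inner (transpose A *v b) h = inner b (A *v h)"
    using tr[of a "transpose G" h] tr[of b "transpose A" h] by (simp_all del: transpose_matrix_vector)
  have t2: "inner (d * (A *v a)) k = inner a (transpose A *v (d * k))"
    by (simp only: inner_vec_times_left tr)
  have t3: "inner ((1 - d) * b) k = inner b ((1 - d) * k)"
    by (rule inner_vec_times_left)
  show "inner x (transpose (coderivative_matrix G A d) *v join_vec h k) =
      inner x (join_vec (G *v h + transpose A *v (d * k)) (A *v h - (1 - d) * k))"
    unfolding x tr coderivative_matrix_mult inner_join_vec
    by (simp only: inner_add_left inner_add_right inner_diff_left inner_diff_right t1 t2 t3)
qed

lemma coderivative_matrix_nonsingular_iff: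
  "det (coderivative_matrix G A d) \<noteq> 0 \<longleftrightarrow>
     (\<forall>a b. transpose G *v a + transpose A *v b = 0 \<and> d * (A *v a) = (1 - d) * b \<longrightarrow> a = 0 \<and> b = 0)"
proof -
  have "det (coderivative_matrix G A d) \<noteq> 0 \<longleftrightarrow>
     (\<forall>a b. coderivative_matrix G A d *v join_vec a b = 0 \<longrightarrow> join_vec a b = 0)"
    unfolding det_nonzero_iff_kernel by (metis join_vec_exhaust)
  then show ?thesis
    by (simp add: coderivative_matrix_mult del: transpose_matrix_vector)
qed

lemma coderivative_matrix_nonsingular_iff_transpose:
  "det (coderivative_matrix G A d) \<noteq> 0 \<longleftrightarrow>
     (\<forall>h k. G *v h + transpose A *v (d * k) = 0 \<and> A *v h = (1 - d) * k \<longrightarrow> h = 0 \<and> k = 0)"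
proof -
  have "det (coderivative_matrix G A d) \<noteq> 0 \<longleftrightarrow>
     (\<forall>h k. transpose (coderivative_matrix G A d) *v join_vec h k = 0 \<longrightarrow> join_vec h k = 0)"
    unfolding det_nonzero_iff_kernel[of "transpose (coderivative_matrix G A d)", unfolded det_transpose]
    by (metis join_vec_exhaust)
  then show ?thesis
    by (simp add: transpose_coderivative_matrix_mult del: transpose_matrix_vector)
qed

text \<open>\<open>lo\<close> and \<open>hi\<close> hold the rows at the two extreme corners of the
  box of weights. They coincide off \<open>\<beta>\<close>, so combining them with arbitrary weights
  from the full cube produces only matrices with weights in the box; \<open>wt\<close> discards the
  irrelevant coordinates.\<close>

lemma coderivative_matrix_nonsingular_weights:
  fixes G :: "real^'n^'n" and A :: "real^'n^'m"
  assumes disj: "\<alpha> \<inter> \<beta> = {}"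
    and edge: "\<And>d k. d \<in> weights \<alpha> \<beta> \<Longrightarrow> (\<forall>i. i \<noteq> k \<longrightarrow> d $ i = 0 \<or> d $ i = 1) \<Longrightarrow>
      det (coderivative_matrix G A d) \<noteq> 0"
    and d: "d \<in> weights \<alpha> \<beta>"
  shows "det (coderivative_matrix G A d) \<noteq> 0"
proof -
  define lo :: "'n + 'm \<Rightarrow> real^('n + 'm)" where "lo i = (case i of
       Inl p \<Rightarrow> join_vec (column p G) (column p A)
     | Inr p \<Rightarrow> if p \<in> \<alpha> then join_vec (row p A) 0 else join_vec 0 (- axis p 1))" for i
  define hi :: "'n + 'm \<Rightarrow> real^('n + 'm)" where "hi i = (case i of
       Inl p \<Rightarrow> join_vec (column p G) (column p A)
     | Inr p \<Rightarrow> if p \<in> \<alpha> \<union> \<beta> then join_vec (row p A) 0 else join_vec 0 (- axis p 1))" for i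
  define wt :: "('n + 'm \<Rightarrow> real) \<Rightarrow> real^'m" where
    "wt e = (\<chi> p. if p \<in> \<alpha> then 1 else if p \<in> \<beta> then e (Inr p) else 0)" for e
  have eq: "(\<chi> i. (1 - e i) *\<^sub>R lo i + e i *\<^sub>R hi i) = coderivative_matrix G A (wt e)" for e
    by (simp add: vec_eq_iff coderivative_matrix_def lo_def hi_def wt_def split: sum.split)
      (auto simp: algebra_simps)
  define c where "c i = (case i of Inl p \<Rightarrow> 0 | Inr p \<Rightarrow> d $ p)" for i :: "'n + 'm"
  have "det (\<chi> i. (1 - c i) *\<^sub>R lo i + c i *\<^sub>R hi i) \<noteq> 0"
  proof (rule det_row_combinations_nonzero)
    fix e :: "'n + 'm \<Rightarrow> real" and k
    assume e: "\<forall>i. 0 \<le> e i \<and> e i \<le> 1" "\<forall>i. i \<noteq> k \<longrightarrow> e i = 0 \<or> e i = 1"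
    have "wt e \<in> weights \<alpha> \<beta>"
      using e disj by (auto simp: mem_weights_iff wt_def)
    \<comment> \<open>For \<open>k = Inl p\<close> no component of \<open>wt e\<close> is
      fractional, and any index serves as \<open>k'\<close>.\<close>
    moreover have "\<exists>k'. \<forall>i. i \<noteq> k' \<longrightarrow> wt e $ i = 0 \<or> wt e $ i = 1"
      by (cases k; rule exI[of _ "case k of Inr p \<Rightarrow> p | Inl _ \<Rightarrow> undefined"])
        (use e in \<open>auto simp: wt_def\<close>)
    ultimately show "det (\<chi> i. (1 - e i) *\<^sub>R lo i + e i *\<^sub>R hi i) \<noteq> 0"
      using edge by (auto simp: eq)
  next
    show "\<forall>i. 0 \<le> c i \<and> c i \<le> 1"
      using d disj by (auto simp: mem_weights_iff c_def split: sum.split)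
        (metis order_refl zero_le_one UnE)+
  qed
  moreover have "wt c = d"
    using d disj by (auto simp: mem_weights_iff vec_eq_iff wt_def c_def)
  ultimately show ?thesis
    by (simp add: eq)
qed

section \<open>The partition criterion as nonsingularity over the box of weights\<close>

lemma sum_scaleR_row_eq_transpose_mult:
  fixes A :: "real^'n^'m" and w :: "real^'m"
  assumes "\<And>i. i \<notin> I \<Longrightarrow> w $ i = 0"
  shows "(\<Sum>i\<in>I. w $ i *\<^sub>R row i A) = transpose A *v w"
proof -
  have "(\<Sum>i\<in>I. w $ i *\<^sub>R row i A) = (\<Sum>i\<in>UNIV. w $ i *\<^sub>R row i A)"
    using assms by (intro sum.mono_neutral_left) auto
  then show ?thesis
    by (simp add: vec_eq_iff matrix_vector_mult_def transpose_def row_def mult.commute del: transpose_matrix_vector)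
qed

text \<open>The condition of the theorem for an arbitrary matrix \<open>A\<close> in place of the
  Jacobian, which makes its analysis pure linear algebra.\<close>

definition partition_criterion :: "real^'n^'n \<Rightarrow> real^'n^'m \<Rightarrow> 'm set \<Rightarrow> 'm set \<Rightarrow> bool" where
  "partition_criterion G A \<alpha> \<beta> \<longleftrightarrow>
    (\<forall>\<beta>p \<beta>0 \<beta>m. \<beta> = \<beta>p \<union> \<beta>0 \<union> \<beta>m \<and> \<beta>p \<inter> \<beta>0 = {} \<and> \<beta>p \<inter> \<beta>m = {} \<and> \<beta>0 \<inter> \<beta>m = {} \<longrightarrow>
       (\<forall>w1 w2. transpose G *v w1 =
           (\<Sum>i\<in>\<alpha> \<union> \<beta>p. w2 $ i *\<^sub>R row i A) + (\<Sum>i\<in>\<beta>0. w2 $ i *\<^sub>R row i A) \<and>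
         (\<forall>i\<in>\<alpha> \<union> \<beta>p. (A *v w1) $ i = 0) \<and> (\<forall>i\<in>\<beta>0. (A *v w1) $ i \<le> 0) \<and> (\<forall>i\<in>\<beta>0. w2 $ i \<ge> 0)
         \<longrightarrow> w1 = 0 \<and> (\<forall>i\<in>\<alpha> \<union> \<beta>p \<union> \<beta>0. w2 $ i = 0)))"

text \<open>A weight yields the partition into the indices of \<open>\<beta>\<close> where it is 1,
  fractional or 0. Conversely, a partition and a pair \<open>w1\<close>, \<open>w2\<close>
  satisfying the premises determine a weight whose matrix has \<open>w1\<close> and the negative of
  the truncated \<open>w2\<close> in its kernel.\<close>

lemma partition_criterion_iff_nonsingular:
  fixes G :: "real^'n^'n" and A :: "real^'n^'m"
  assumes disj: "\<alpha> \<inter> \<beta> = {}"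
  shows "partition_criterion G A \<alpha> \<beta> \<longleftrightarrow> (\<forall>d\<in>weights \<alpha> \<beta>. det (coderivative_matrix G A d) \<noteq> 0)"
proof (intro iffI ballI)
  fix d assume crit: "partition_criterion G A \<alpha> \<beta>" and "d \<in> weights \<alpha> \<beta>"
  show "det (coderivative_matrix G A d) \<noteq> 0"
  proof (rule coderivative_matrix_nonsingular_weights[OF disj _ \<open>d \<in> weights \<alpha> \<beta>\<close>])
    fix d k
    assume d: "d \<in> weights \<alpha> \<beta>" and edge: "\<forall>i. i \<noteq> k \<longrightarrow> d $ i = 0 \<or> d $ i = 1"
    \<comment> \<open>\<open>\<beta>0\<close> contains at most the index \<open>k\<close>, so the
      sign of \<open>b $ k\<close> is the only one to arrange; \<open>comp\<close> then forces the
      sign of \<open>(A *v a) $ k\<close>.\<close>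
    have kernel: "a = 0 \<and> b = 0"
      if ab: "transpose G *v a + transpose A *v b = 0" "d * (A *v a) = (1 - d) * b" and sign: "b $ k \<le> 0" for a b
    proof -
      define \<beta>p \<beta>0 \<beta>m where "\<beta>p = {i\<in>\<beta>. d $ i = 1}" and "\<beta>0 = {i\<in>\<beta>. 0 < d $ i \<and> d $ i < 1}"
        and "\<beta>m = {i\<in>\<beta>. d $ i = 0}"
      define w where "w = - b"
      have part: "\<beta> = \<beta>p \<union> \<beta>0 \<union> \<beta>m \<and> \<beta>p \<inter> \<beta>0 = {} \<and> \<beta>p \<inter> \<beta>m = {} \<and> \<beta>0 \<inter> \<beta>m = {}"
        using d disj by (force simp: \<beta>p_def \<beta>0_def \<beta>m_def mem_weights_iff)
      have \<beta>0k: "i = k" if "i \<in> \<beta>0" for i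
        using that edge by (force simp: \<beta>0_def)
      have comp: "d $ i * (A *v a) $ i = - (1 - d $ i) * w $ i" for i
        using ab(2) by (simp add: vec_eq_iff w_def flip: mult_minus_left)
      have w0: "w $ i = 0" if "i \<notin> (\<alpha> \<union> \<beta>p) \<union> \<beta>0" for i
      proof -
        have "d $ i = 0"
          using that part d disj by (auto simp: mem_weights_iff \<beta>m_def)
        then show ?thesis
          using comp[of i] by simp
      qed
      have "transpose G *v a = transpose A *v w"
        using ab(1) unfolding w_def
        by (simp add: vec.neg eq_neg_iff_add_eq_0 del: transpose_matrix_vector)
      also have "\<dots> = (\<Sum>i\<in>(\<alpha> \<union> \<beta>p) \<union> \<beta>0. w $ i *\<^sub>R row i A)"
        using w0 by (intro sum_scaleR_row_eq_transpose_mult[symmetric])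
      also have "\<dots> = (\<Sum>i\<in>\<alpha> \<union> \<beta>p. w $ i *\<^sub>R row i A) + (\<Sum>i\<in>\<beta>0. w $ i *\<^sub>R row i A)"
        using part disj by (intro sum.union_disjoint) auto
      finally have 1: "transpose G *v a =
          (\<Sum>i\<in>\<alpha> \<union> \<beta>p. w $ i *\<^sub>R row i A) + (\<Sum>i\<in>\<beta>0. w $ i *\<^sub>R row i A)" .
      have 2: "(A *v a) $ i = 0" if "i \<in> \<alpha> \<union> \<beta>p" for i
        using comp[of i] that d disj by (auto simp: mem_weights_iff \<beta>p_def)
      have 4: "w $ i \<ge> 0" if "i \<in> \<beta>0" for i
        using \<beta>0k[OF that] sign by (simp add: w_def)
      have 3: "(A *v a) $ i \<le> 0" if "i \<in> \<beta>0" for i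
      proof -
        have "0 < d $ i" "d $ i < 1"
          using that by (auto simp: \<beta>0_def)
        then have "d $ i * (A *v a) $ i \<le> 0"
          unfolding comp using 4[OF that] by (intro mult_nonpos_nonneg) simp_all
        with \<open>0 < d $ i\<close> show ?thesis
          by (simp add: mult_le_0_iff)
      qed
      have "a = 0 \<and> (\<forall>i\<in>\<alpha> \<union> \<beta>p \<union> \<beta>0. w $ i = 0)"
        by (rule crit[unfolded partition_criterion_def, THEN spec, THEN spec, THEN spec, THEN mp,
            OF part, THEN spec, THEN spec, THEN mp]) (use 1 2 3 4 in auto)
      with w0 show ?thesis
        by (auto simp: w_def vec_eq_iff)
    qed
    show "det (coderivative_matrix G A d) \<noteq> 0"
      unfolding coderivative_matrix_nonsingular_iff
    proof (intro allI impI)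
      fix a b assume ab: "transpose G *v a + transpose A *v b = 0 \<and> d * (A *v a) = (1 - d) * b"
      show "a = 0 \<and> b = 0"
      proof (cases "b $ k \<le> 0")
        case True
        with ab show ?thesis
          by (intro kernel) auto
      next
        case False
        \<comment> \<open>The kernel is closed under negation, which reduces the remaining sign to
          the case already settled.\<close>
        have "transpose G *v (-a) + transpose A *v (-b) = - (transpose G *v a + transpose A *v b)"
          by (simp add: vec.neg del: transpose_matrix_vector)
        then have "transpose G *v (-a) + transpose A *v (-b) = 0"
          using ab by (metis neg_equal_0_iff_equal)
        then have "- a = 0 \<and> - b = 0"
          using ab False by (intro kernel) (auto simp: vec.neg)
        then show ?thesis
          by simp
      qed
    qed
  qed
next
  assume ns: "\<forall>d\<in>weights \<alpha> \<beta>. det (coderivative_matrix G A d) \<noteq> 0"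
  show "partition_criterion G A \<alpha> \<beta>"
    unfolding partition_criterion_def
  proof (intro allI impI, (elim conjE)?)
    fix \<beta>p \<beta>0 \<beta>m w1 w2
    assume part: "\<beta> = \<beta>p \<union> \<beta>0 \<union> \<beta>m" "\<beta>p \<inter> \<beta>0 = {}" "\<beta>p \<inter> \<beta>m = {}" "\<beta>0 \<inter> \<beta>m = {}"
      and eq: "transpose G *v w1 =
           (\<Sum>i\<in>\<alpha> \<union> \<beta>p. w2 $ i *\<^sub>R row i A) + (\<Sum>i\<in>\<beta>0. w2 $ i *\<^sub>R row i A)"
      and z: "\<forall>i\<in>\<alpha> \<union> \<beta>p. (A *v w1) $ i = 0" and neg: "\<forall>i\<in>\<beta>0. (A *v w1) $ i \<le> 0"
      and pos: "\<forall>i\<in>\<beta>0. w2 $ i \<ge> 0"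
    let ?I = "(\<alpha> \<union> \<beta>p) \<union> \<beta>0"
    \<comment> \<open>Components of \<open>w2\<close> outside \<open>?I\<close> are unconstrained
      and are cut off.\<close>
    define b where "b = (\<chi> i. if i \<in> ?I then w2 $ i else 0)"
    \<comment> \<open>On \<open>\<beta>0\<close> this solves \<open>d (A w1) = - (1 - d) w2\<close>
      for \<open>d\<close>; the sign conditions place the quotient in \<open>[0,1]\<close>. If both
      entries vanish every value solves the equation, and division by zero supplies 0.\<close>
    define d where "d = (\<chi> i. if i \<in> \<alpha> \<union> \<beta>p then 1 else if i \<in> \<beta>0
        then w2 $ i / (w2 $ i - (A *v w1) $ i) else 0)"
    have "d \<in> weights \<alpha> \<beta>"
      unfolding mem_weights_iff[OF disj] using disj part pos neg
      by (auto simp: d_def intro!: divide_nonneg_nonneg) (auto simp: divide_le_eq_1 not_less dest!: bspec)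
    with ns have kernel: "\<And>a b. transpose G *v a + transpose A *v b = 0 \<and> d * (A *v a) = (1 - d) * b \<Longrightarrow>
        a = 0 \<and> b = 0"
      unfolding coderivative_matrix_nonsingular_iff by blast
    have "transpose G *v w1 = (\<Sum>i\<in>?I. w2 $ i *\<^sub>R row i A)"
      unfolding eq using part disj by (intro sum.union_disjoint[symmetric]) auto
    also have "\<dots> = (\<Sum>i\<in>?I. b $ i *\<^sub>R row i A)"
      by (intro sum.cong) (auto simp: b_def)
    also have "\<dots> = transpose A *v b"
      by (intro sum_scaleR_row_eq_transpose_mult) (auto simp: b_def)
    finally have "transpose G *v w1 + transpose A *v (- b) = 0"
      by (simp add: vec.neg del: transpose_matrix_vector)
    moreover have "(d * (A *v w1)) $ i = ((1 - d) * (- b)) $ i" for i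
    proof -
      consider "i \<in> \<alpha> \<union> \<beta>p" | "i \<in> \<beta>0" "i \<notin> \<alpha> \<union> \<beta>p" | "i \<notin> ?I"
        by blast
      then show ?thesis
      proof cases
        case 2
        then have *: "w2 $ i \<ge> 0" "(A *v w1) $ i \<le> 0"
          using pos neg by auto
        show ?thesis
        proof (cases "w2 $ i - (A *v w1) $ i = 0")
          case True
          with * have "w2 $ i = 0" "(A *v w1) $ i = 0"
            by auto
          then show ?thesis
            by (simp add: b_def)
        next
          case False
          with 2 show ?thesis
            by (simp add: b_def d_def field_simps)
        qed
      qed (use z in \<open>auto simp: b_def d_def\<close>)
    qed
    ultimately have "w1 = 0 \<and> - b = 0"
      by (intro kernel) (simp add: vec_eq_iff)
    then have w1: "w1 = 0" and b: "b = 0"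
      by auto
    have "w2 $ i = 0" if "i \<in> ?I" for i
    proof -
      have "w2 $ i = b $ i"
        using that by (simp add: b_def)
      then show ?thesis
        by (simp add: b)
    qed
    with w1 show "w1 = 0 \<and> (\<forall>i\<in>?I. w2 $ i = 0)"
      by blast
  qed
qed

subsection \<open>The projection onto the polar cone\<close>

text \<open>The metric projection onto \<open>polar (constraint_cone E)\<close>.\<close>

definition polar_proj :: "'m::finite set \<Rightarrow> real^'m \<Rightarrow> real^'m" where
  "polar_proj E t = (\<chi> i. if i \<in> E then t $ i else max (t $ i) 0)"

lemma polar_proj_nth: "polar_proj E t $ i = (if i \<in> E then t $ i else max (t $ i) 0)"
  by (simp add: polar_proj_def)

text \<open>The variational characterization of the nearest point: \<open>z\<close> is normal at
  \<open>y\<close> exactly if \<open>y + z\<close> projects to \<open>y\<close>. The cone is a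
  product of lines and half-lines, so everything can be checked coordinatewise.\<close>

lemma mem_normal_cone_iff_polar_proj:
  "z \<in> normal_cone (polar (constraint_cone E)) y \<longleftrightarrow> polar_proj E (y + z) = y"
proof
  assume "z \<in> normal_cone (polar (constraint_cone E)) y"
  then have y: "\<And>i. i \<notin> E \<Longrightarrow> 0 \<le> y $ i"
    and z: "\<And>c. (\<And>i. i \<notin> E \<Longrightarrow> 0 \<le> c $ i) \<Longrightarrow> inner z (c - y) \<le> 0"
    by (auto simp: normal_cone_def polar_constraint_cone split: if_splits)
  \<comment> \<open>Test points differing from \<open>y\<close> in one coordinate. Steps of both
    signs annihilate \<open>z $ i\<close> on \<open>E\<close>; off \<open>E\<close>, the step 1
    gives its sign and the step \<open>- y $ i\<close> gives complementarity.\<close>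
  have move: "r * z $ i \<le> 0" if "i \<in> E \<or> 0 \<le> y $ i + r" for i r
  proof -
    have "inner z (y + r *\<^sub>R axis i 1 - y) \<le> 0"
      by (rule z) (use that y in \<open>auto simp: axis_def\<close>)
    then show ?thesis
      by (simp add: inner_axis)
  qed
  have "polar_proj E (y + z) $ i = y $ i" for i
  proof (cases "i \<in> E")
    case True
    then show ?thesis
      using move[of i 1] move[of i "-1"] by (simp add: polar_proj_nth)
  next
    case False
    have "z $ i \<le> 0"
      using move[of i 1] y[OF False] by simp
    moreover have "0 \<le> y $ i * z $ i"
      using move[of i "- y $ i"] by simp
    ultimately have "y $ i = 0 \<or> z $ i = 0"
      using y[OF False] by (auto simp: zero_le_mult_iff)
    then show ?thesis
      using False y[OF False] \<open>z $ i \<le> 0\<close> by (auto simp: polar_proj_nth)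
  qed
  then show "polar_proj E (y + z) = y"
    by (simp add: vec_eq_iff)
next
  assume "polar_proj E (y + z) = y"
  then have comp: "y $ i = (if i \<in> E then y $ i + z $ i else max (y $ i + z $ i) 0)" for i
    by (metis polar_proj_nth vector_add_component)
  have y: "0 \<le> y $ i" if "i \<notin> E" for i
    using comp[of i] that by simp
  have "inner z (c - y) \<le> 0" if c: "\<And>i. i \<notin> E \<Longrightarrow> 0 \<le> c $ i" for c
    unfolding inner_vec_def
  proof (rule sum_nonpos)
    fix i
    show "inner (z $ i) ((c - y) $ i) \<le> 0"
    proof (cases "i \<in> E \<or> z $ i = 0")
      case True
      then show ?thesis
        using comp[of i] by auto
    next
      case False
      then have "y $ i = 0" "z $ i \<le> 0" "0 \<le> c $ i"
        using comp[of i] c[of i] by (auto simp: max_def split: if_splits)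
      then show ?thesis
        by (simp add: mult_nonpos_nonneg)
    qed
  qed
  with y show "z \<in> normal_cone (polar (constraint_cone E)) y"
    by (simp add: normal_cone_def polar_constraint_cone)
qed

lemma norm_polar_proj_diff_le: "norm (polar_proj E s - polar_proj E t) \<le> norm (s - t)"
  by (rule norm_le_componentwise_cart) (auto simp: polar_proj_nth)

lemma tendsto_polar_proj [tendsto_intros]:
  assumes "(f \<longlongrightarrow> l) F"
  shows "((\<lambda>x. polar_proj E (f x)) \<longlongrightarrow> polar_proj E l) F"
proof -
  have "((\<lambda>x. f x - l) \<longlongrightarrow> 0) F"
    using assms by (simp add: LIM_zero)
  then have "((\<lambda>x. polar_proj E (f x) - polar_proj E l) \<longlongrightarrow> 0) F"
    by (rule Lim_transform_bound[rotated]) (simp add: norm_polar_proj_diff_le)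
  then show ?thesis
    by (rule LIM_zero_cancel)
qed

text \<open>Nonzero coordinates of \<open>tb\<close> keep their sign nearby, so the slope there is
  fixed at 1 or 0; at a zero coordinate off \<open>E\<close> the difference quotient of the positive
  part lies in \<open>[0,1]\<close>.\<close>

lemma polar_proj_diff_weights:
  fixes E :: "'m::finite set" and tb :: "real^'m"
  defines "\<alpha> \<equiv> {i. i \<in> E \<or> 0 < tb $ i}" and "\<beta> \<equiv> {i. i \<notin> E \<and> tb $ i = 0}"
  shows "\<forall>\<^sub>F p in nhds (tb, tb). \<exists>d\<in>weights \<alpha> \<beta>.
    polar_proj E (fst p) - polar_proj E (snd p) = d * (fst p - snd p)"
proof -
  have disj: "\<alpha> \<inter> \<beta> = {}"
    by (auto simp: \<alpha>_def \<beta>_def)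
  have lim: "((\<lambda>p. fst p $ i) \<longlongrightarrow> tb $ i) (nhds (tb, tb))"
    "((\<lambda>p. snd p $ i) \<longlongrightarrow> tb $ i) (nhds (tb, tb))" for i
    by (auto intro!: tendsto_eq_intros filterlim_ident)
  have "\<forall>\<^sub>F p in nhds (tb, tb). (0 < tb $ i \<longrightarrow> 0 < fst p $ i \<and> 0 < snd p $ i) \<and>
      (tb $ i < 0 \<longrightarrow> fst p $ i < 0 \<and> snd p $ i < 0)" for i
    using order_tendstoD[OF lim(1)[of i], of 0] order_tendstoD[OF lim(2)[of i], of 0]
    by (cases "tb $ i" "0 :: real" rule: linorder_cases) (auto intro: eventually_conj)
  then have "\<forall>\<^sub>F p in nhds (tb, tb). \<forall>i. (0 < tb $ i \<longrightarrow> 0 < fst p $ i \<and> 0 < snd p $ i) \<and>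
      (tb $ i < 0 \<longrightarrow> fst p $ i < 0 \<and> snd p $ i < 0)"
    by (rule eventually_all_finite)
  then show ?thesis
  proof eventually_elim
    case (elim p)
    obtain s t where p: "p = (s, t)"
      by (cases p)
    define d where "d = (\<chi> i. if i \<in> \<alpha> then 1 else if i \<in> \<beta> then
        (if s $ i = t $ i then 0 else (max (s $ i) 0 - max (t $ i) 0) / (s $ i - t $ i)) else 0)"
    have "d \<in> weights \<alpha> \<beta>"
      unfolding mem_weights_iff[OF disj] d_def using disj
      by (auto simp: max_def divide_simps)
    moreover have "(polar_proj E s - polar_proj E t) $ i = (d * (s - t)) $ i" for i
      using elim[rule_format, of i]
      by (cases "tb $ i" "0 :: real" rule: linorder_cases)
        (auto simp: polar_proj_nth d_def \<alpha>_def \<beta>_def p)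
    ultimately show ?case
      by (auto simp: vec_eq_iff p)
  qed
qed

text \<open>A localization can rule out kernel vectors for a given weight only if that weight occurs
  between actual points arbitrarily close to \<open>tb\<close>.\<close>

lemma polar_proj_weights_realized:
  fixes E :: "'m::finite set" and tb k :: "real^'m"
  defines "\<alpha> \<equiv> {i. i \<in> E \<or> 0 < tb $ i}" and "\<beta> \<equiv> {i. i \<notin> E \<and> tb $ i = 0}"
  assumes d: "d \<in> weights \<alpha> \<beta>"
  obtains a where "\<forall>\<^sub>F \<tau> in at_right 0.
    polar_proj E (tb + \<tau> *\<^sub>R a) - polar_proj E (tb + \<tau> *\<^sub>R (a - k)) = \<tau> *\<^sub>R (d * k)"
proof -
  have disj: "\<alpha> \<inter> \<beta> = {}"
    by (auto simp: \<alpha>_def \<beta>_def)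
  \<comment> \<open>At an index of \<open>\<beta>\<close> the interval between \<open>a - k\<close>
    and \<open>a\<close> straddles 0, placed so that the share \<open>d $ i\<close> of its length is
    positive. The sign of \<open>k $ i\<close> decides which endpoint is the positive one.\<close>
  define a where "a = (\<chi> i. if i \<in> \<beta> then if 0 \<le> k $ i then d $ i * k $ i else (1 - d $ i) * k $ i else 0)"
  have lim: "((\<lambda>\<tau>. tb $ i - \<tau> * k $ i) \<longlongrightarrow> tb $ i) (at_right 0)" for i
    by (auto intro!: tendsto_eq_intros)
  have "\<forall>\<^sub>F \<tau> in at_right 0. (0 < tb $ i \<longrightarrow> 0 < tb $ i - \<tau> * k $ i) \<and>
      (tb $ i < 0 \<longrightarrow> tb $ i - \<tau> * k $ i < 0)" for i
    using order_tendstoD[OF lim[of i], of 0]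
    by (cases "tb $ i" "0 :: real" rule: linorder_cases) (auto intro: eventually_conj)
  then have "\<forall>\<^sub>F \<tau> in at_right 0. \<forall>i. (0 < tb $ i \<longrightarrow> 0 < tb $ i - \<tau> * k $ i) \<and>
      (tb $ i < 0 \<longrightarrow> tb $ i - \<tau> * k $ i < 0)"
    by (rule eventually_all_finite)
  then have "\<forall>\<^sub>F \<tau> in at_right 0.
    polar_proj E (tb + \<tau> *\<^sub>R a) - polar_proj E (tb + \<tau> *\<^sub>R (a - k)) = \<tau> *\<^sub>R (d * k)"
    using eventually_at_right_less[of "0 :: real"]
  proof eventually_elim
    case (elim \<tau>)
    have "(polar_proj E (tb + \<tau> *\<^sub>R a) - polar_proj E (tb + \<tau> *\<^sub>R (a - k))) $ i = (\<tau> *\<^sub>R (d * k)) $ i" for i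
    proof (cases "i \<in> \<beta>")
      case False
      then show ?thesis
        using elim(1)[rule_format, of i] d unfolding mem_weights_iff[OF disj]
        by (cases "tb $ i" "0 :: real" rule: linorder_cases)
          (auto simp: polar_proj_nth a_def \<alpha>_def \<beta>_def algebra_simps)
    next
      case True
      then have i: "i \<notin> E" "tb $ i = 0" "0 \<le> d $ i" "d $ i \<le> 1"
        using d True unfolding mem_weights_iff[OF disj] by (auto simp: \<beta>_def)
      show ?thesis
      proof (cases "0 \<le> k $ i")
        case nonneg: True
        have "0 \<le> \<tau> * (d $ i * k $ i)"
          using i nonneg elim(2) by simp
        moreover have "\<tau> * (d $ i * k $ i - k $ i) \<le> 0"
        proof (intro mult_nonneg_nonpos)
          have "d $ i * k $ i \<le> 1 * k $ i"
            using i nonneg by (intro mult_right_mono)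
          then show "d $ i * k $ i - k $ i \<le> 0"
            by simp
        qed (use elim in simp)
        ultimately show ?thesis
          using True nonneg i by (simp add: polar_proj_nth a_def)
      next
        case neg: False
        have "\<tau> * ((1 - d $ i) * k $ i) \<le> 0"
          using i neg elim(2) by (intro mult_nonneg_nonpos) auto
        moreover have "0 \<le> \<tau> * ((1 - d $ i) * k $ i - k $ i)"
        proof (intro mult_nonneg_nonneg)
          have "1 * k $ i \<le> (1 - d $ i) * k $ i"
            using i neg by (intro mult_right_mono_neg) auto
          then show "0 \<le> (1 - d $ i) * k $ i - k $ i"
            by simp
        qed (use elim in simp)
        ultimately show ?thesis
          using True neg i by (simp add: polar_proj_nth a_def algebra_simps)
      qed
    qed
    then show ?case
      by (simp add: vec_eq_iff)
  qed
  then show thesis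
    by (rule that)
qed

section \<open>Norms on products and a bound uniform in the weights\<close>

lemma norm_Pair_mono:
  "norm a \<le> norm c \<Longrightarrow> norm b \<le> norm d \<Longrightarrow> norm (a, b) \<le> norm (c, d)"
  by (auto simp: norm_Pair intro!: real_sqrt_le_mono add_mono power_mono)

lemma norm_fst_prod_le: "norm (fst z) \<le> norm z"
  and norm_snd_prod_le: "norm (snd z) \<le> norm z"
  by (cases z; simp add: norm_fst_le norm_snd_le)+

lemma eventually_nhds_pair_ball:
  fixes q :: "'a::metric_space"
  assumes "\<forall>\<^sub>F p in nhds (q, q). P (fst p) (snd p)"
  obtains r where "r > 0" "\<And>a b. a \<in> ball q r \<Longrightarrow> b \<in> ball q r \<Longrightarrow> P a b"
proof -
  obtain Q where Q: "eventually Q (nhds q)" "\<And>a b. Q a \<Longrightarrow> Q b \<Longrightarrow> P a b"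
    using assms unfolding nhds_prod eventually_prod_same by auto
  then obtain r where "r > 0" "\<And>a. dist a q < r \<Longrightarrow> Q a"
    unfolding eventually_nhds_metric by blast
  with Q(2) show thesis
    by (intro that[of r]) (auto simp: dist_commute)
qed

text \<open>\<open>c\<close> is the minimum over weights and unit vectors, a compact set;
  nonsingularity makes it positive and homogeneity extends the bound to all vectors.\<close>

lemma nonsingular_weights_bound:
  fixes T :: "('a::euclidean_space \<times> (real^'m)) \<times> 'w::euclidean_space \<Rightarrow> 'a \<times> (real^'m)"
  assumes T: "bounded_linear T"
    and ns: "\<And>d h k. d \<in> weights \<alpha> \<beta> \<Longrightarrow> T ((h, d * k), 0) = (0, (1 - d) * k) \<Longrightarrow> h = 0 \<and> k = 0"
  obtains c where "c > 0" "\<And>d h k. d \<in> weights \<alpha> \<beta> \<Longrightarrow>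
    c * norm (h, k) \<le> norm (T ((h, d * k), 0) - (0, (1 - d) * k))"
proof (cases "weights \<alpha> \<beta> = {}")
  case True
  then show thesis
    using that[of 1] by simp
next
  case False
  define M where "M = (\<lambda>(d, z). T ((fst z, d * snd z), 0) - (0, (1 - d) * snd z))"
  let ?K = "weights \<alpha> \<beta> \<times> sphere (0 :: 'a \<times> (real^'m)) 1"
  have times: "a * b = (\<chi> i. a $ i * b $ i)" for a b :: "real^'m"
    by (simp add: vec_eq_iff)
  have "continuous_on ?K (\<lambda>q. norm (M q))"
    unfolding M_def case_prod_unfold times
    by (intro continuous_intros bounded_linear.continuous_on[OF T])
  moreover have "compact ?K"
    unfolding weights_def by (intro compact_Times compact_cbox compact_sphere)
  moreover have "?K \<noteq> {}"
    using False by (auto simp: sphere_eq_empty)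
  ultimately obtain q where q: "q \<in> ?K" "\<And>q'. q' \<in> ?K \<Longrightarrow> norm (M q) \<le> norm (M q')"
    using continuous_attains_inf[of ?K "\<lambda>q. norm (M q)"] by blast
  obtain d h k where dhk: "q = (d, (h, k))"
    by (metis prod.exhaust)
  have "norm (M q) > 0"
  proof (rule ccontr)
    assume "\<not> ?thesis"
    then have "T ((h, d * k), 0) = (0, (1 - d) * k)"
      by (simp add: M_def dhk)
    then have "h = 0 \<and> k = 0"
      using q(1) by (intro ns[of d]) (auto simp: dhk)
    with q(1) show False
      by (simp add: dhk zero_prod_def[symmetric])
  qed
  moreover have "norm (M q) * norm (h, k) \<le> norm (T ((h, d * k), 0) - (0, (1 - d) * k))"
    if d: "d \<in> weights \<alpha> \<beta>" for d h k
  proof (cases "(h, k) = 0")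
    case False
    define n where "n = norm (h, k)"
    have n: "n > 0"
      using False by (simp add: n_def)
    have scale: "d * (r *\<^sub>R k) = r *\<^sub>R (d * k)" for r and d k :: "real^'m"
      by (simp add: vec_eq_iff)
    have "(d, (1 / n) *\<^sub>R (h, k)) \<in> ?K"
      using d n by (simp add: n_def del: scaleR_Pair)
    moreover have "M (d, (1 / n) *\<^sub>R (h, k)) = (1 / n) *\<^sub>R (T ((h, d * k), 0) - (0, (1 - d) * k))"
      using linear_scale[OF bounded_linear.linear[OF T], of "1 / n" "((h, d * k), 0)"]
      by (simp add: M_def scale scaleR_diff_right)
    ultimately have "norm (M q) \<le> (1 / n) * norm (T ((h, d * k), 0) - (0, (1 - d) * k))"
      using q(2)[of "(d, (1 / n) *\<^sub>R (h, k))"] n by (simp only: norm_scaleR) simp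
    then show ?thesis
      using n by (simp add: n_def field_simps)
  qed (simp add: zero_prod_def)
  ultimately show thesis
    by (rule that)
qed

subsection \<open>Localizations of parametric complementarity problems\<close>

text \<open>The game is reduced to one strictly differentiable map: the first component of
  \<open>\<Theta>\<close> is the stationarity residual, the second the constraint value.
  \<open>tb\<close> is the reference point in the variable of the normal map.\<close>

locale parametric_complementarity =
  fixes E :: "'m::finite set"
    and \<Theta> :: "('a::euclidean_space \<times> (real^'m)) \<times> 'w::euclidean_space \<Rightarrow> 'a \<times> (real^'m)"
    and T :: "('a \<times> (real^'m)) \<times> 'w \<Rightarrow> 'a \<times> (real^'m)"
    and xb :: 'a and yb :: "real^'m" and wb :: 'w
    and tb :: "real^'m" and \<alpha> \<beta> :: "'m set"
  defines "tb \<equiv> yb + snd (\<Theta> ((xb, yb), wb))"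
    and "\<alpha> \<equiv> {i. i \<in> E \<or> 0 < tb $ i}"
    and "\<beta> \<equiv> {i. i \<notin> E \<and> tb $ i = 0}"
  assumes strict: "has_strict_derivative \<Theta> T ((xb, yb), wb)"
    and base_fst: "fst (\<Theta> ((xb, yb), wb)) = 0"
    and base_snd: "polar_proj E tb = yb"
begin

definition solutions :: "'w \<times> 'a \<times> (real^'m) \<Rightarrow> ('a \<times> (real^'m)) set" where
  "solutions = (\<lambda>(w, v, u). {(x, y). fst (\<Theta> ((x, y), w)) = v \<and>
     polar_proj E (y + snd (\<Theta> ((x, y), w)) - u) = y})"

abbreviation state :: "('a \<times> (real^'m)) \<times> 'w \<Rightarrow> ('a \<times> (real^'m)) \<times> 'w" where
  "state q \<equiv> ((fst (fst q), polar_proj E (snd (fst q))), snd q)"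

text \<open>
  Robinson's normal map: the solutions for \<open>(w, v, u)\<close> are the points \<open>(x, polar_proj E t)\<close> with
  \<open>normal_map ((x, t), w) = (v, u)\<close>.
\<close>

definition normal_map :: "('a \<times> (real^'m)) \<times> 'w \<Rightarrow> 'a \<times> (real^'m)" where
  "normal_map q = \<Theta> (state q) - (0, snd (fst q) - polar_proj E (snd (fst q)))"

abbreviation qb :: "('a \<times> (real^'m)) \<times> 'w" where
  "qb \<equiv> ((xb, tb), wb)"

lemma normal_map_qb: "normal_map qb = 0"
  using base_fst by (simp add: normal_map_def base_snd prod_eq_iff) (simp add: tb_def)

lemma solution_normal_map:
  "(x, polar_proj E t) \<in> solutions (w, normal_map ((x, t), w))"
  by (simp add: solutions_def normal_map_def case_prod_unfold)

text \<open>The inverse change of variables. Its formula for \<open>t\<close> is explicit, hence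
  continuous at the reference solution, which later confines \<open>t\<close> to a prescribed
  ball.\<close>

lemma normal_map_solution:
  assumes "(x, y) \<in> solutions (w, v, u)"
  defines "t \<equiv> y + snd (\<Theta> ((x, y), w)) - u"
  shows "polar_proj E t = y" "normal_map ((x, t), w) = (v, u)"
proof -
  show "polar_proj E t = y"
    using assms by (simp add: solutions_def)
  then show "normal_map ((x, t), w) = (v, u)"
    using assms by (simp add: solutions_def normal_map_def prod_eq_iff)
qed

lemma norm_state_diff_le: "norm (state p - state q) \<le> norm (p - q)"
proof -
  obtain x t w x' t' w' where pq: "p = ((x, t), w)" "q = ((x', t'), w')"
    by (metis prod.exhaust)
  have "norm (x - x', polar_proj E t - polar_proj E t') \<le> norm (x - x', t - t')"
    by (intro norm_Pair_mono norm_polar_proj_diff_le) simp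
  then have "norm ((x - x', polar_proj E t - polar_proj E t'), w - w') \<le> norm ((x - x', t - t'), w - w')"
    by (rule norm_Pair_mono) simp
  then show ?thesis
    by (simp only: pq fst_conv snd_conv diff_Pair)
qed

lemma state_tendsto:
  "((\<lambda>p. (state (fst p), state (snd p))) \<longlongrightarrow> (((xb, yb), wb), ((xb, yb), wb))) (nhds (qb, qb))"
  by (auto intro!: tendsto_eq_intros filterlim_ident simp: base_snd)

text \<open>The term \<open>t - P(t)\<close> enters both sides identically and cancels, so the error
  is that of \<open>\<Theta>\<close> alone, evaluated at states that are no farther apart than the
  original points.\<close>

lemma normal_map_expansion:
  assumes "\<epsilon> > 0"
  shows "\<forall>\<^sub>F p in nhds (qb, qb).
    norm (normal_map (fst p) - normal_map (snd p) - (T (state (fst p) - state (snd p)) -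
        (0, snd (fst (fst p - snd p)) - snd (fst (state (fst p) - state (snd p))))))
      \<le> \<epsilon> * norm (fst p - snd p)"
proof -
  have "\<forall>\<^sub>F p in nhds (qb, qb).
      norm (\<Theta> (state (fst p)) - \<Theta> (state (snd p)) - T (state (fst p) - state (snd p)))
      \<le> \<epsilon> * norm (state (fst p) - state (snd p))"
    using state_tendsto has_strict_derivativeD[OF strict assms] by (auto simp: filterlim_iff)
  then show ?thesis
  proof eventually_elim
    case (elim p)
    have "normal_map (fst p) - normal_map (snd p) - (T (state (fst p) - state (snd p)) -
        (0, snd (fst (fst p - snd p)) - snd (fst (state (fst p) - state (snd p))))) =
        \<Theta> (state (fst p)) - \<Theta> (state (snd p)) - T (state (fst p) - state (snd p))"
      by (simp add: normal_map_def prod_eq_iff)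
    also have "norm \<dots> \<le> \<epsilon> * norm (state (fst p) - state (snd p))"
      by (rule elim)
    also have "\<dots> \<le> \<epsilon> * norm (fst p - snd p)"
      using assms by (intro mult_left_mono norm_state_diff_le) simp
    finally show ?case .
  qed
qed

lemma normal_map_Lipschitz:
  obtains K where "K > 0"
    "\<forall>\<^sub>F p in nhds (qb, qb). norm (normal_map (fst p) - normal_map (snd p)) \<le> K * norm (fst p - snd p)"
proof -
  obtain K where K: "K > 0" "\<forall>\<^sub>F p in nhds (((xb, yb), wb), ((xb, yb), wb)).
      norm (\<Theta> (fst p) - \<Theta> (snd p)) \<le> K * norm (fst p - snd p)"
    using has_strict_derivative_Lipschitz[OF strict] by blast
  have "\<forall>\<^sub>F p in nhds (qb, qb).
      norm (\<Theta> (state (fst p)) - \<Theta> (state (snd p))) \<le> K * norm (state (fst p) - state (snd p))"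
    using state_tendsto K(2) by (auto simp: filterlim_iff)
  \<comment> \<open>\<open>K\<close> accounts for \<open>\<Theta>\<close>, and 2 for
    \<open>t - P(t)\<close>, a difference of two nonexpansive maps.\<close>
  then have "\<forall>\<^sub>F p in nhds (qb, qb).
      norm (normal_map (fst p) - normal_map (snd p)) \<le> (K + 2) * norm (fst p - snd p)"
  proof eventually_elim
    case (elim p)
    define r where "r q = (0 :: 'a, snd (fst q) - polar_proj E (snd (fst q)))" for q :: "('a \<times> (real^'m)) \<times> 'w"
    have "norm (r (fst p) - r (snd p)) \<le> norm (snd (fst (fst p - snd p))) +
        norm (polar_proj E (snd (fst (fst p))) - polar_proj E (snd (fst (snd p))))"
      using norm_triangle_ineq4[of "snd (fst (fst p - snd p))"
          "polar_proj E (snd (fst (fst p))) - polar_proj E (snd (fst (snd p)))"]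
      by (simp add: r_def norm_Pair algebra_simps)
    also have "\<dots> \<le> norm (snd (fst (fst p - snd p))) + norm (snd (fst (fst p - snd p)))"
      using norm_polar_proj_diff_le[of E "snd (fst (fst p))" "snd (fst (snd p))"] by simp
    also have "norm (snd (fst (fst p - snd p))) \<le> norm (fst p - snd p)"
      by (rule order_trans[OF norm_snd_prod_le norm_fst_prod_le])
    finally have "norm (r (fst p) - r (snd p)) \<le> 2 * norm (fst p - snd p)"
      by simp
    moreover have "K * norm (state (fst p) - state (snd p)) \<le> K * norm (fst p - snd p)"
      using K(1) by (intro mult_left_mono norm_state_diff_le) simp
    moreover have "normal_map (fst p) - normal_map (snd p) =
        (\<Theta> (state (fst p)) - \<Theta> (state (snd p))) - (r (fst p) - r (snd p))"
      by (simp add: normal_map_def r_def algebra_simps)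
    then have "norm (normal_map (fst p) - normal_map (snd p)) \<le>
        norm (\<Theta> (state (fst p)) - \<Theta> (state (snd p))) + norm (r (fst p) - r (snd p))"
      by (simp only: norm_triangle_ineq4)
    ultimately show ?case
      using elim unfolding distrib_right by linarith
  qed
  with K(1) show thesis
    by (intro that[of "K + 2"]) auto
qed

lemma normal_map_tendsto: "(normal_map \<longlongrightarrow> 0) (nhds qb)"
proof -
  have "((\<lambda>q. \<Theta> (state q)) \<longlongrightarrow> \<Theta> ((xb, yb), wb)) (nhds qb)"
    by (rule filterlim_compose[OF has_strict_derivative_tendsto[OF strict]])
      (auto intro!: tendsto_eq_intros filterlim_ident simp: base_snd)
  then have "(normal_map \<longlongrightarrow> \<Theta> ((xb, yb), wb) - (0, tb - polar_proj E tb)) (nhds qb)"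
    unfolding normal_map_def
    by (auto intro!: tendsto_eq_intros filterlim_ident)
  then show ?thesis
    using normal_map_qb by (simp add: normal_map_def base_snd)
qed

text \<open>The localization controls \<open>x\<close> and \<open>P(t)\<close> by \<open>L\<close>
  times the difference of normal map values. The rest, \<open>t - P(t)\<close>, is the second
  component of \<open>\<Theta>\<close> minus that of the normal map, which adds
  \<open>K * L + 1\<close>. Points with parameter \<open>wb\<close> suffice, as kernel directions
  leave \<open>w\<close> unchanged.\<close>

lemma localization_imp_lower_bound:
  assumes "has_lipschitz_localization solutions (wb, 0, 0) (xb, yb)"
  obtains C where "C > 0" "\<forall>\<^sub>F p in nhds (qb, qb). snd (fst p) = wb \<and> snd (snd p) = wb \<longrightarrow>
    norm (fst p - snd p) \<le> C * norm (normal_map (fst p) - normal_map (snd p))"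
proof -
  obtain U V s L where UV: "open U" "(wb, 0, 0) \<in> U" "open V" "(xb, yb) \<in> V"
    and s: "L-lipschitz_on U s"
    and graph: "{(p, z). p \<in> U \<and> z = s p} = {(p, z). z \<in> solutions p} \<inter> (U \<times> V)"
    using assms unfolding has_lipschitz_localization_def by blast
  have L: "L \<ge> 0"
    using s by (rule lipschitz_on_nonneg)
  obtain K where K: "K > 0" "\<forall>\<^sub>F p in nhds (((xb, yb), wb), ((xb, yb), wb)).
      norm (\<Theta> (fst p) - \<Theta> (snd p)) \<le> K * norm (fst p - snd p)"
    using has_strict_derivative_Lipschitz[OF strict] by blast
  have "((\<lambda>q. (wb, normal_map q)) \<longlongrightarrow> (wb, 0, 0)) (nhds qb)"
    using normal_map_tendsto by (auto intro!: tendsto_eq_intros simp: zero_prod_def)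
  then have inU: "\<forall>\<^sub>F q in nhds qb. (wb, normal_map q) \<in> U"
    using UV(1,2) by (rule topological_tendstoD)
  have "((\<lambda>q. fst (state q)) \<longlongrightarrow> (xb, yb)) (nhds qb)"
    by (auto intro!: tendsto_eq_intros filterlim_ident simp: base_snd)
  then have inV: "\<forall>\<^sub>F q in nhds qb. fst (state q) \<in> V"
    using UV(3,4) by (rule topological_tendstoD)
  have good: "\<forall>\<^sub>F q in nhds qb. snd q = wb \<longrightarrow> (wb, normal_map q) \<in> U \<and> fst (state q) = s (wb, normal_map q)"
    using inU inV
  proof eventually_elim
    case (elim q)
    show ?case
    proof
      assume "snd q = wb"
      then have "fst (state q) \<in> solutions (wb, normal_map q)"
        using solution_normal_map[of "fst (fst q)" "snd (fst q)" "snd q"]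
        by (simp flip: \<open>snd q = wb\<close>)
      with elim have "((wb, normal_map q), fst (state q)) \<in> {(p, z). z \<in> solutions p} \<inter> (U \<times> V)"
        by auto
      then show "(wb, normal_map q) \<in> U \<and> fst (state q) = s (wb, normal_map q)"
        unfolding graph[symmetric] by auto
    qed
  qed
  have "\<forall>\<^sub>F p in nhds (qb, qb).
      norm (\<Theta> (state (fst p)) - \<Theta> (state (snd p))) \<le> K * norm (state (fst p) - state (snd p))"
    using state_tendsto K(2) by (auto simp: filterlim_iff)
  moreover have "\<forall>\<^sub>F p in nhds (qb, qb). snd (fst p) = wb \<longrightarrow>
      (wb, normal_map (fst p)) \<in> U \<and> fst (state (fst p)) = s (wb, normal_map (fst p))"
    using tendsto_fst_nhds good by (auto simp: filterlim_iff)
  moreover have "\<forall>\<^sub>F p in nhds (qb, qb). snd (snd p) = wb \<longrightarrow>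
      (wb, normal_map (snd p)) \<in> U \<and> fst (state (snd p)) = s (wb, normal_map (snd p))"
    using tendsto_snd_nhds good by (auto simp: filterlim_iff)
  ultimately have "\<forall>\<^sub>F p in nhds (qb, qb). snd (fst p) = wb \<and> snd (snd p) = wb \<longrightarrow>
    norm (fst p - snd p) \<le> (L + K * L + 1) * norm (normal_map (fst p) - normal_map (snd p))"
  proof eventually_elim
    case (elim p)
    show ?case
    proof
      assume w: "snd (fst p) = wb \<and> snd (snd p) = wb"
      define a where "a = fst p"
      define b where "b = snd p"
      define n where "n = norm (normal_map a - normal_map b)"
      have "norm (fst (state a) - fst (state b)) \<le> L * norm ((wb, normal_map a) - (wb, normal_map b))"
        using lipschitz_onD[OF s, of "(wb, normal_map a)" "(wb, normal_map b)"] elim w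
        by (simp add: dist_norm a_def b_def)
      then have 1: "norm (fst (state a) - fst (state b)) \<le> L * n"
        by (simp add: norm_Pair n_def)
      have "norm (state a - state b) = norm (fst (state a) - fst (state b))"
        using w by (simp add: norm_Pair a_def b_def)
      with elim have "norm (\<Theta> (state a) - \<Theta> (state b)) \<le> K * norm (fst (state a) - fst (state b))"
        by (simp add: a_def b_def)
      also have "\<dots> \<le> K * (L * n)"
        using 1 K(1) by (intro mult_left_mono) auto
      finally have 2: "norm (\<Theta> (state a) - \<Theta> (state b)) \<le> K * (L * n)" .
      define r where "r q = (0 :: 'a, snd (fst q) - polar_proj E (snd (fst q)))" for q :: "('a \<times> (real^'m)) \<times> 'w"
      have "r a - r b = (\<Theta> (state a) - \<Theta> (state b)) - (normal_map a - normal_map b)"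
        by (simp add: normal_map_def r_def algebra_simps)
      then have 3: "norm (r a - r b) \<le> K * (L * n) + n"
        using 2 norm_triangle_ineq4[of "\<Theta> (state a) - \<Theta> (state b)" "normal_map a - normal_map b"]
        by (simp add: n_def)
      have "fst (a - b) = (fst (state a) - fst (state b)) + (r a - r b)"
        by (simp add: r_def prod_eq_iff)
      then have "norm (fst (a - b)) \<le> L * n + (K * (L * n) + n)"
        using 1 3 norm_triangle_ineq[of "fst (state a) - fst (state b)" "r a - r b"] by simp
      moreover have "norm (a - b) = norm (fst (a - b))"
        using w by (simp add: norm_prod_def a_def b_def)
      ultimately show "norm (fst p - snd p) \<le> (L + K * L + 1) * norm (normal_map (fst p) - normal_map (snd p))"
        by (simp add: a_def b_def n_def algebra_simps)
    qed
  qed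
  moreover have "L + K * L + 1 > 0"
    using L K(1) by (simp add: add_nonneg_pos)
  ultimately show thesis
    by (intro that)
qed

text \<open>A kernel vector gives two points at distance proportional to \<open>\<tau>\<close> whose
  normal map values differ only by the error of the expansion, against the lower bound.\<close>

lemma localization_imp_nonsingular:
  assumes loc: "has_lipschitz_localization solutions (wb, 0, 0) (xb, yb)"
    and d: "d \<in> weights \<alpha> \<beta>" and ker: "T ((h, d * k), 0) = (0, (1 - d) * k)"
  shows "h = 0 \<and> k = 0"
proof -
  obtain C where C: "C > 0" and lower: "\<forall>\<^sub>F p in nhds (qb, qb). snd (fst p) = wb \<and> snd (snd p) = wb \<longrightarrow>
    norm (fst p - snd p) \<le> C * norm (normal_map (fst p) - normal_map (snd p))"
    using localization_imp_lower_bound[OF loc] by blast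
  obtain a where a: "\<forall>\<^sub>F \<tau> in at_right 0.
    polar_proj E (tb + \<tau> *\<^sub>R a) - polar_proj E (tb + \<tau> *\<^sub>R (a - k)) = \<tau> *\<^sub>R (d * k)"
    using polar_proj_weights_realized[OF d[unfolded \<alpha>_def \<beta>_def]] by blast
  define q where "q \<tau> = ((xb + \<tau> *\<^sub>R h, tb + \<tau> *\<^sub>R a), wb)" for \<tau>
  define q' where "q' \<tau> = ((xb, tb + \<tau> *\<^sub>R (a - k)), wb)" for \<tau>
  have lim: "((\<lambda>\<tau>. (q \<tau>, q' \<tau>)) \<longlongrightarrow> (qb, qb)) (at_right 0)"
    unfolding q_def q'_def by (auto intro!: tendsto_eq_intros)
  \<comment> \<open>With this tolerance the expansion and the lower bound leave the distance at most
    half of itself.\<close>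
  have "1 / (2 * C) > 0"
    using C by simp
  note normal_map_expansion[OF this]
  then have exp: "\<forall>\<^sub>F \<tau> in at_right 0.
    norm (normal_map (q \<tau>) - normal_map (q' \<tau>) - (T (state (q \<tau>) - state (q' \<tau>)) -
        (0, snd (fst (q \<tau> - q' \<tau>)) - snd (fst (state (q \<tau>) - state (q' \<tau>))))))
      \<le> 1 / (2 * C) * norm (q \<tau> - q' \<tau>)"
    using lim by (auto simp: filterlim_iff)
  have low: "\<forall>\<^sub>F \<tau> in at_right 0. norm (q \<tau> - q' \<tau>) \<le> C * norm (normal_map (q \<tau>) - normal_map (q' \<tau>))"
    using lim lower by (auto simp: filterlim_iff q_def q'_def)
  have "\<forall>\<^sub>F \<tau> in at_right (0::real). h = 0 \<and> k = 0"
    using exp low a eventually_at_right_less[of "0 :: real"]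
  proof eventually_elim
    case (elim \<tau>)
    have dq: "q \<tau> - q' \<tau> = ((\<tau> *\<^sub>R h, \<tau> *\<^sub>R k), 0)"
      by (simp add: q_def q'_def scaleR_diff_right)
    have ds: "state (q \<tau>) - state (q' \<tau>) = \<tau> *\<^sub>R ((h, d * k), 0)"
      using elim(3) by (simp add: q_def q'_def)
    have "T (state (q \<tau>) - state (q' \<tau>)) = \<tau> *\<^sub>R (0, (1 - d) * k)"
      unfolding ds linear_scale[OF bounded_linear.linear[OF has_strict_derivative_linear[OF strict]]] ker ..
    moreover have "\<tau> *\<^sub>R k - \<tau> *\<^sub>R (d * k) = \<tau> *\<^sub>R ((1 - d) * k)"
      by (simp add: vec_eq_iff algebra_simps)
    ultimately have "norm (normal_map (q \<tau>) - normal_map (q' \<tau>)) \<le> 1 / (2 * C) * norm (q \<tau> - q' \<tau>)"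
      using elim(1) unfolding dq ds by simp
    then have "C * norm (normal_map (q \<tau>) - normal_map (q' \<tau>)) \<le> norm (q \<tau> - q' \<tau>) / 2"
      using C by (simp add: field_simps)
    with elim(2) have "norm (q \<tau> - q' \<tau>) \<le> 0"
      by linarith
    then show ?case
      using elim(4) by (simp add: dq zero_prod_def)
  qed
  then show ?thesis
    by (simp add: eventually_const_iff trivial_limit_at_right_real)
qed

lemma nonsingular_imp_lower_bound:
  assumes ns: "\<And>d h k. d \<in> weights \<alpha> \<beta> \<Longrightarrow> T ((h, d * k), 0) = (0, (1 - d) * k) \<Longrightarrow> h = 0 \<and> k = 0"
  obtains c where "c > 0" "\<forall>\<^sub>F p in nhds (qb, qb). snd (fst p) = snd (snd p) \<longrightarrow>
    c * norm (fst p - snd p) \<le> norm (normal_map (fst p) - normal_map (snd p))"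
proof -
  obtain c where c: "c > 0" "\<And>d h k. d \<in> weights \<alpha> \<beta> \<Longrightarrow>
      c * norm (h, k) \<le> norm (T ((h, d * k), 0) - (0, (1 - d) * k))"
    by (rule nonsingular_weights_bound[OF has_strict_derivative_linear[OF strict], of \<alpha> \<beta>])
      (erule (1) ns, blast)
  have "((\<lambda>p. (snd (fst (fst p)), snd (fst (snd p)))) \<longlongrightarrow> (tb, tb)) (nhds (qb, qb))"
    by (auto intro!: tendsto_eq_intros filterlim_ident)
  then have "\<forall>\<^sub>F p in nhds (qb, qb). \<exists>d\<in>weights \<alpha> \<beta>.
      polar_proj E (snd (fst (fst p))) - polar_proj E (snd (fst (snd p))) =
      d * (snd (fst (fst p)) - snd (fst (snd p)))"
    using polar_proj_diff_weights[where E = E and tb = tb] unfolding \<alpha>_def \<beta>_def filterlim_iff by force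
  \<comment> \<open>Half of the uniform bound \<open>c\<close> absorbs the expansion error; the
    other half survives.\<close>
  moreover have "c / 2 > 0"
    using c(1) by simp
  note normal_map_expansion[OF this]
  ultimately have "\<forall>\<^sub>F p in nhds (qb, qb). snd (fst p) = snd (snd p) \<longrightarrow>
    c / 2 * norm (fst p - snd p) \<le> norm (normal_map (fst p) - normal_map (snd p))"
  proof eventually_elim
    case (elim p)
    show ?case
    proof
      assume w: "snd (fst p) = snd (snd p)"
      define h where "h = fst (fst (fst p - snd p))"
      define k where "k = snd (fst (fst p - snd p))"
      obtain d where d: "d \<in> weights \<alpha> \<beta>"
        "polar_proj E (snd (fst (fst p))) - polar_proj E (snd (fst (snd p))) = d * k"
        using elim(1) by (auto simp: k_def)
      have ds: "state (fst p) - state (snd p) = ((h, d * k), 0)"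
        using d(2) w by (simp add: h_def)
      have dp: "fst p - snd p = ((h, k), 0)"
        using w by (simp add: h_def k_def prod_eq_iff)
      have "k - d * k = (1 - d) * k"
        by (simp add: algebra_simps)
      with elim(2) have "norm (normal_map (fst p) - normal_map (snd p) - (T ((h, d * k), 0) - (0, (1 - d) * k)))
          \<le> c / 2 * norm (h, k)"
        unfolding ds dp by (simp add: norm_Pair)
      moreover have "c * norm (h, k) \<le> norm (T ((h, d * k), 0) - (0, (1 - d) * k))"
        by (rule c(2)[OF d(1)])
      ultimately have "c / 2 * norm (h, k) \<le> norm (normal_map (fst p) - normal_map (snd p))"
        using norm_triangle_ineq2[of "T ((h, d * k), 0) - (0, (1 - d) * k)"
            "normal_map (fst p) - normal_map (snd p)"]
        by (simp add: norm_minus_commute)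
      then show "c / 2 * norm (fst p - snd p) \<le> norm (normal_map (fst p) - normal_map (snd p))"
        by (simp add: dp norm_Pair)
    qed
  qed
  with c(1) show thesis
    by (intro that[of "c / 2"]) auto
qed

text \<open>The lower bound inverts the normal map at each fixed \<open>w\<close>; the upper
  Lipschitz bound handles changes of \<open>w\<close>. What remains is to match neighborhoods in
  \<open>(x, t)\<close> with neighborhoods in \<open>(x, y)\<close>.\<close>

lemma lower_bound_imp_localization:
  assumes c: "c > 0" and low: "\<forall>\<^sub>F p in nhds (qb, qb). snd (fst p) = snd (snd p) \<longrightarrow>
    c * norm (fst p - snd p) \<le> norm (normal_map (fst p) - normal_map (snd p))"
  shows "has_lipschitz_localization solutions (wb, 0, 0) (xb, yb)"
proof -
  obtain K where K: "K > 0"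
    "\<forall>\<^sub>F p in nhds (qb, qb). norm (normal_map (fst p) - normal_map (snd p)) \<le> K * norm (fst p - snd p)"
    using normal_map_Lipschitz by blast
  have "\<forall>\<^sub>F p in nhds (qb, qb).
      norm (normal_map (fst p) - normal_map (snd p)) \<le> K * norm (fst p - snd p) \<and>
      (snd (fst p) = snd (snd p) \<longrightarrow>
        c * norm (fst p - snd p) \<le> norm (normal_map (fst p) - normal_map (snd p)))"
    using K(2) low by eventually_elim simp
  then obtain r where r: "r > 0"
    and near: "\<And>p q. p \<in> ball qb r \<Longrightarrow> q \<in> ball qb r \<Longrightarrow>
      norm (normal_map p - normal_map q) \<le> K * norm (p - q) \<and>
      (snd p = snd q \<longrightarrow> c * norm (p - q) \<le> norm (normal_map p - normal_map q))"
    by (rule eventually_nhds_pair_ball) blast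
  \<comment> \<open>\<open>B\<close> is a product, so that the state of one point may be combined
    with the parameter of another; half radii keep it inside the ball of radius
    \<open>r\<close>.\<close>
  define Z where "Z = ball (xb, tb) (r / 2)"
  define B where "B = Z \<times> ball wb (r / 2)"
  have B_sub: "B \<subseteq> ball qb r"
  proof
    fix q assume "q \<in> B"
    then have "dist (fst q) (xb, tb) < r / 2" "dist (snd q) wb < r / 2"
      by (auto simp: B_def Z_def dist_commute)
    moreover have "q - qb = (fst q - (xb, tb), snd q - wb)"
      by (simp add: prod_eq_iff)
    ultimately have "norm (q - qb) < r"
      using norm_Pair_le[of "fst q - (xb, tb)" "snd q - wb"] by (simp add: dist_norm)
    then show "q \<in> ball qb r"
      by (simp add: dist_norm norm_minus_commute)
  qed
  have upper: "norm (normal_map p - normal_map q) \<le> K * norm (p - q)" if "p \<in> B" "q \<in> B" for p q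
    using near B_sub that by blast
  have lower: "c * norm (z - z') \<le> norm (normal_map (z, w) - normal_map (z', w))"
    if "(z, w) \<in> B" "(z', w) \<in> B" for z z' w
    using near[OF subsetD[OF B_sub that(1)] subsetD[OF B_sub that(2)]] by (simp add: norm_Pair)
  have "open B"
    unfolding B_def Z_def by (intro open_Times open_ball)
  have "qb \<in> B"
    using r by (simp add: B_def Z_def)
  \<comment> \<open>Carrying \<open>w\<close> along equalizes the dimensions for invariance of
    domain and makes the image open jointly in parameter and perturbation.\<close>
  define \<Psi> where "\<Psi> q = (normal_map q, snd q)" for q
  have inj: "inj_on \<Psi> B"
  proof (rule inj_onI)
    fix p q assume "p \<in> B" "q \<in> B" "\<Psi> p = \<Psi> q"
    moreover obtain z w z' w' where pq: "p = (z, w)" "q = (z', w')"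
      by (metis prod.exhaust)
    ultimately have "(z, w) \<in> B" "(z', w) \<in> B" "w = w'" "normal_map (z, w) = normal_map (z', w)"
      by (auto simp: \<Psi>_def)
    with lower[of z w z'] c show "p = q"
      by (auto simp: pq mult_le_0_iff)
  qed
  have "K-lipschitz_on B normal_map"
    using upper K(1) by (intro lipschitz_onI) (simp_all add: dist_norm)
  then have "continuous_on B normal_map"
    by (rule lipschitz_on_continuous_on)
  then have "continuous_on B \<Psi>"
    unfolding \<Psi>_def by (intro continuous_on_Pair continuous_on_snd continuous_on_id)
  then have "open (\<Psi> ` B)"
    using \<open>open B\<close> inj by (rule invariance_of_domain)
  define U0 where "U0 = (\<lambda>p. (snd p, fst p)) -` (\<Psi> ` B)"
  have "open U0"
    unfolding U0_def using \<open>open (\<Psi> ` B)\<close> by (intro open_vimage continuous_intros) auto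
  define \<sigma> where "\<sigma> p = (SOME z. (z, fst p) \<in> B \<and> normal_map (z, fst p) = snd p)" for p
  have \<sigma>: "(\<sigma> p, fst p) \<in> B" "normal_map (\<sigma> p, fst p) = snd p" if "p \<in> U0" for p
  proof -
    have "(snd p, fst p) \<in> \<Psi> ` B"
      using that by (simp add: U0_def)
    then obtain q where "q \<in> B" "(snd p, fst p) = \<Psi> q"
      by blast
    then have "(fst q, fst p) \<in> B \<and> normal_map (fst q, fst p) = snd p"
      by (simp add: \<Psi>_def)
    then have "(\<sigma> p, fst p) \<in> B \<and> normal_map (\<sigma> p, fst p) = snd p"
      unfolding \<sigma>_def by (rule someI)
    then show "(\<sigma> p, fst p) \<in> B" "normal_map (\<sigma> p, fst p) = snd p"
      by auto
  qed
  have \<sigma>_unique: "z = \<sigma> p" if "p \<in> U0" "(z, fst p) \<in> B" "normal_map (z, fst p) = snd p" for z p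
    using inj_onD[OF inj, of "(z, fst p)" "(\<sigma> p, fst p)"] \<sigma>[OF that(1)] that by (simp add: \<Psi>_def)
  define s where "s p = fst (state (\<sigma> p, fst p))" for p
  have s_sol: "s p \<in> solutions p" if "p \<in> U0" for p
    using solution_normal_map[of "fst (\<sigma> p)" "snd (\<sigma> p)" "fst p"] \<sigma>[OF that] by (simp add: s_def)
  have s_lip: "norm (s p - s p') \<le> (1 + K) / c * norm (p - p')" if p: "p \<in> U0" "p' \<in> U0" for p p'
  proof -
    \<comment> \<open>The lower bound needs a common parameter, so \<open>\<sigma> p'\<close> is
      moved to the parameter of \<open>p\<close>. The move costs \<open>K\<close>, the change of
      perturbation 1, which gives \<open>(1 + K) / c\<close>.\<close>
    have mid: "(\<sigma> p', fst p) \<in> B"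
      using \<sigma>(1)[OF p(1)] \<sigma>(1)[OF p(2)] by (auto simp: B_def)
    have "norm (s p - s p') \<le> norm (\<sigma> p - \<sigma> p')"
      using norm_state_diff_le[of "(\<sigma> p, wb)" "(\<sigma> p', wb)"] by (simp add: s_def norm_Pair)
    moreover have "c * norm (\<sigma> p - \<sigma> p') \<le> norm (normal_map (\<sigma> p, fst p) - normal_map (\<sigma> p', fst p))"
      by (rule lower[OF \<sigma>(1)[OF p(1)] mid])
    moreover have "normal_map (\<sigma> p, fst p) - normal_map (\<sigma> p', fst p) =
        (snd p - snd p') + (normal_map (\<sigma> p', fst p') - normal_map (\<sigma> p', fst p))"
      using \<sigma>(2)[OF p(1)] \<sigma>(2)[OF p(2)] by simp
    then have "norm (normal_map (\<sigma> p, fst p) - normal_map (\<sigma> p', fst p)) \<le>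
        norm (snd p - snd p') + norm (normal_map (\<sigma> p', fst p') - normal_map (\<sigma> p', fst p))"
      by (simp only: norm_triangle_ineq)
    moreover have "norm (normal_map (\<sigma> p', fst p') - normal_map (\<sigma> p', fst p)) \<le> K * norm (fst p - fst p')"
      using upper[OF \<sigma>(1)[OF p(2)] mid] by (simp add: norm_Pair norm_minus_commute)
    moreover have "norm (snd p - snd p') \<le> norm (p - p')" "norm (fst p - fst p') \<le> norm (p - p')"
      using norm_snd_prod_le[of "p - p'"] norm_fst_prod_le[of "p - p'"] by simp_all
    then have "norm (snd p - snd p') + K * norm (fst p - fst p') \<le> norm (p - p') + K * norm (p - p')"
      using K(1) by (intro add_mono mult_left_mono) auto
    ultimately have "c * norm (\<sigma> p - \<sigma> p') \<le> (1 + K) * norm (p - p')" and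
      le: "norm (s p - s p') \<le> norm (\<sigma> p - \<sigma> p')"
      by (auto simp: algebra_simps)
    then have "norm (\<sigma> p - \<sigma> p') \<le> (1 + K) / c * norm (p - p')"
      using c by (simp add: field_simps)
    with le show ?thesis
      by linarith
  qed
  then have lip: "((1 + K) / c)-lipschitz_on U0 s"
    using K(1) c by (intro lipschitz_onI) (auto simp: dist_norm)
  let ?pb = "(wb, 0, 0) :: 'w \<times> 'a \<times> (real^'m)"
  have pb: "?pb \<in> U0" "s ?pb = (xb, yb)"
  proof -
    have "(0, wb) = \<Psi> qb"
      by (simp add: \<Psi>_def normal_map_qb)
    then show 1: "?pb \<in> U0"
      using \<open>qb \<in> B\<close> by (auto simp: U0_def zero_prod_def)
    have "(xb, tb) = \<sigma> ?pb"
      using \<open>qb \<in> B\<close> normal_map_qb by (intro \<sigma>_unique[OF 1]) (auto simp: zero_prod_def)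
    then show "s ?pb = (xb, yb)"
      by (simp add: s_def base_snd flip: \<open>(xb, tb) = \<sigma> ?pb\<close>)
  qed
  \<comment> \<open>Uniqueness is known only for \<open>(x, t)\<close> in \<open>Z\<close>. By
    continuity of \<open>t\<close> in the solution and the perturbation, \<open>U1\<close> and
    \<open>V\<close> can be chosen so that every solution in \<open>V\<close> has its
    \<open>(x, t)\<close> there.\<close>
  have "((\<lambda>pz. \<Theta> (snd pz, fst (fst pz))) \<longlongrightarrow> \<Theta> ((xb, yb), wb)) (nhds (?pb, (xb, yb)))"
    by (rule filterlim_compose[OF has_strict_derivative_tendsto[OF strict]])
      (auto intro!: tendsto_eq_intros filterlim_ident)
  then have "((\<lambda>pz. (fst (snd pz), snd (snd pz) + snd (\<Theta> (snd pz, fst (fst pz))) - snd (snd (fst pz))))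
      \<longlongrightarrow> (xb, tb)) (nhds (?pb, (xb, yb)))"
    by (auto intro!: tendsto_eq_intros filterlim_ident simp: tb_def)
  then have "\<forall>\<^sub>F pz in nhds (?pb, (xb, yb)).
      (fst (snd pz), snd (snd pz) + snd (\<Theta> (snd pz, fst (fst pz))) - snd (snd (fst pz))) \<in> Z"
    using r by (intro topological_tendstoD) (auto simp: Z_def)
  then obtain W where W: "open W" "(?pb, (xb, yb)) \<in> W" "\<forall>pz\<in>W.
      (fst (snd pz), snd (snd pz) + snd (\<Theta> (snd pz, fst (fst pz))) - snd (snd (fst pz))) \<in> Z"
    unfolding eventually_nhds by blast
  obtain U1 V where "open U1" "open V" "(?pb, (xb, yb)) \<in> U1 \<times> V" "U1 \<times> V \<subseteq> W"
    by (rule open_prod_elim[OF W(1,2)])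
  then have U1: "open U1" "?pb \<in> U1" and V: "open V" "(xb, yb) \<in> V" and sub: "U1 \<times> V \<subseteq> W"
    by auto
  have in_Z: "(fst z, snd z + snd (\<Theta> (z, fst p)) - snd (snd p)) \<in> Z" if "p \<in> U1" "z \<in> V" for p z
    using bspec[OF W(3), of "(p, z)"] sub that by auto
  \<comment> \<open>The preimage of \<open>V\<close> keeps the values of \<open>s\<close> in
    \<open>V\<close>; the ball for \<open>w\<close> completes membership in
    \<open>B\<close>.\<close>
  define U where "U = s -` V \<inter> (U0 \<inter> U1 \<inter> fst -` ball wb (r / 2))"
  have "open (U0 \<inter> U1 \<inter> fst -` ball wb (r / 2))"
    using \<open>open U0\<close> U1(1) by (intro open_Int open_vimage_fst) auto
  moreover have "continuous_on (U0 \<inter> U1 \<inter> fst -` ball wb (r / 2)) s"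
    using lipschitz_on_continuous_on[OF lip] by (rule continuous_on_subset) auto
  ultimately have "open U"
    unfolding U_def using V(1) by (metis continuous_on_open_vimage)
  have "?pb \<in> U"
    using pb U1 V r by (simp add: U_def)
  have graph: "p \<in> U \<and> z = s p \<longleftrightarrow> z \<in> solutions p \<and> p \<in> U \<and> z \<in> V" for p z
  proof (intro iffI; elim conjE)
    assume "p \<in> U" "z = s p"
    then show "z \<in> solutions p \<and> p \<in> U \<and> z \<in> V"
      using s_sol by (simp add: U_def)
  next
    assume z: "z \<in> solutions p" "z \<in> V" and p: "p \<in> U"
    define t where "t = snd z + snd (\<Theta> (z, fst p)) - snd (snd p)"
    have sol: "polar_proj E t = snd z" "normal_map ((fst z, t), fst p) = snd p"
      using normal_map_solution[of "fst z" "snd z" "fst p" "fst (snd p)" "snd (snd p)"] z(1)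
      by (simp_all add: t_def)
    have "((fst z, t), fst p) \<in> B"
      using in_Z[of p z] p z(2) by (simp add: t_def B_def U_def)
    then have "(fst z, t) = \<sigma> p"
      using p sol by (intro \<sigma>_unique) (simp_all add: U_def)
    then have "z = s p"
      by (simp add: s_def sol flip: \<open>(fst z, t) = \<sigma> p\<close>)
    with p show "p \<in> U \<and> z = s p"
      by simp
  qed
  show ?thesis
    unfolding has_lipschitz_localization_def
  proof (intro conjI exI)
    show "(xb, yb) \<in> solutions ?pb"
      using s_sol[OF pb(1)] pb(2) by simp
    show "open U" "?pb \<in> U" "open V" "(xb, yb) \<in> V"
      by fact+
    show "s ` U \<subseteq> V"
      by (auto simp: U_def)
    show "((1 + K) / c)-lipschitz_on U s"
      using lip by (rule lipschitz_on_subset) (auto simp: U_def)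
    show "{(p, z). p \<in> U \<and> z = s p} = {(p, z). z \<in> solutions p} \<inter> (U \<times> V)"
      using graph by auto
  qed
qed

lemma localization_iff_nonsingular:
  "has_lipschitz_localization solutions (wb, 0, 0) (xb, yb) \<longleftrightarrow>
    (\<forall>d\<in>weights \<alpha> \<beta>. \<forall>h k. T ((h, d * k), 0) = (0, (1 - d) * k) \<longrightarrow> h = 0 \<and> k = 0)"
proof (intro iffI ballI allI impI)
  assume ns: "\<forall>d\<in>weights \<alpha> \<beta>. \<forall>h k. T ((h, d * k), 0) = (0, (1 - d) * k) \<longrightarrow> h = 0 \<and> k = 0"
  obtain c where "c > 0" "\<forall>\<^sub>F p in nhds (qb, qb). snd (fst p) = snd (snd p) \<longrightarrow>
    c * norm (fst p - snd p) \<le> norm (normal_map (fst p) - normal_map (snd p))"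
    by (rule nonsingular_imp_lower_bound) (use ns in blast)
  then show "has_lipschitz_localization solutions (wb, 0, 0) (xb, yb)"
    by (rule lower_bound_imp_localization)
next
  fix d h k
  assume "has_lipschitz_localization solutions (wb, 0, 0) (xb, yb)" "d \<in> weights \<alpha> \<beta>"
    "T ((h, d * k), 0) = (0, (1 - d) * k)"
  then show "h = 0 \<and> k = 0"
    by (rule localization_imp_nonsingular)
qed

end

subsection \<open>Gradients and Jacobians\<close>

lemma jacobian_mult:
  fixes g :: "real^'n \<Rightarrow> real^'m"
  assumes "(g has_derivative D) (at x)"
  shows "jacobian g (at x) *v h = D h"
proof -
  have "frechet_derivative g (at x) = D"
    using frechet_derivative_at[OF assms] by simp
  then show ?thesis
    by (simp add: jacobian_def matrix_works has_derivative_linear[OF assms])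
qed

lemma twice_differentiable_at_imp_differentiable:
  assumes "twice_differentiable_at h x"
  shows "h differentiable (at x)"
  using assms eventually_nhds_x_imp_x unfolding twice_differentiable_at_def differentiable_def by fast

lemma GDERIV_grad:
  fixes h :: "'a::euclidean_space \<Rightarrow> real"
  assumes "h differentiable (at x)"
  shows "GDERIV h x :> grad h x"
proof -
  obtain D where D: "(h has_derivative D) (at x)"
    using assms unfolding differentiable_def by blast
  have "D = (\<lambda>k. inner k (adjoint D 1))"
    using adjoint_works[OF has_derivative_linear[OF D], of _ 1] by auto
  with D have "GDERIV h x :> adjoint D 1"
    by (simp add: gderiv_def)
  then show ?thesis
    using grad_eqI by metis
qed

lemma grad_add_inner:
  fixes h :: "real^'n \<Rightarrow> real" and g :: "real^'n \<Rightarrow> real^'m"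
  assumes h: "h differentiable (at x)" and g: "g differentiable (at x)"
  shows "grad (\<lambda>x. h x + inner y (g x)) x = grad h x + transpose (jacobian g (at x)) *v y"
proof (rule grad_eqI)
  obtain D where D: "(g has_derivative D) (at x)"
    using g unfolding differentiable_def by blast
  have "inner y (D k) = inner k (transpose (jacobian g (at x)) *v y)" for k
    by (simp add: jacobian_mult[OF D, symmetric] dot_lmul_matrix inner_commute[of k])
  moreover have "((\<lambda>x. inner y (g x)) has_derivative (\<lambda>k. inner y (D k))) (at x)"
    by (rule has_derivative_inner_right[OF D])
  ultimately have "((\<lambda>x. inner y (g x)) has_derivative
      (\<lambda>k. inner k (transpose (jacobian g (at x)) *v y))) (at x)"
    by simp
  then have "GDERIV (\<lambda>x. inner y (g x)) x :> transpose (jacobian g (at x)) *v y"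
    unfolding gderiv_def .
  with GDERIV_grad[OF h] show "GDERIV (\<lambda>x. h x + inner y (g x)) x :> grad h x + transpose (jacobian g (at x)) *v y"
    by (rule GDERIV_add)
qed

subsection \<open>The equilibrium problem\<close>

text \<open>Each coordinate has one owner, so the stationarity conditions of all players form a
  single vector. The constraint term carries no player index because the multiplier is
  shared.\<close>

definition equilibrium_map ::
    "('n::finite \<Rightarrow> 'p) \<Rightarrow> ('p \<Rightarrow> (real^'n) \<times> (real^'d) \<Rightarrow> real) \<Rightarrow> ((real^'n) \<times> (real^'d) \<Rightarrow> real^'m) \<Rightarrow>
     ((real^'n) \<times> (real^'m)) \<times> (real^'d) \<Rightarrow> (real^'n) \<times> (real^'m)" where
  "equilibrium_map owner f F = (\<lambda>((x, y), w).
     ((\<chi> i. grad (\<lambda>x'. f (owner i) (x', w)) x $ i) + transpose (jacobian (\<lambda>x'. F (x', w)) (at x)) *v y,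
      F (x, w)))"

lemma mem_S_Lag_iff:
  "(x, y) \<in> S_Lag owner E f F (w, v, u) \<longleftrightarrow>
     fst (equilibrium_map owner f F ((x, y), w)) = v \<and>
     polar_proj E (y + snd (equilibrium_map owner f F ((x, y), w)) - u) = y"
proof -
  have "0 \<in> (\<lambda>z. - F (x, w) + u + z) ` normal_cone (polar (constraint_cone E)) y \<longleftrightarrow>
      F (x, w) - u \<in> normal_cone (polar (constraint_cone E)) y"
  proof
    assume "0 \<in> (\<lambda>z. - F (x, w) + u + z) ` normal_cone (polar (constraint_cone E)) y"
    then obtain z where "z \<in> normal_cone (polar (constraint_cone E)) y" "0 = - F (x, w) + u + z"
      by blast
    moreover from this(2) have "z = F (x, w) - u"
      by (simp add: algebra_simps eq_neg_iff_add_eq_0)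
    ultimately show "F (x, w) - u \<in> normal_cone (polar (constraint_cone E)) y"
      by simp
  next
    assume "F (x, w) - u \<in> normal_cone (polar (constraint_cone E)) y"
    then show "0 \<in> (\<lambda>z. - F (x, w) + u + z) ` normal_cone (polar (constraint_cone E)) y"
      by (rule rev_image_eqI) simp
  qed
  then show ?thesis
    by (simp add: S_Lag_def equilibrium_map_def mem_normal_cone_iff_polar_proj vec_eq_iff add_diff_eq
        del: transpose_matrix_vector)
qed

lemma bounded_bilinear_transpose_mult:
  "bounded_bilinear (\<lambda>(M :: real^'n^'m) (y :: real^'m). transpose M *v y)"
proof -
  have "bilinear (\<lambda>(M :: real^'n^'m) (y :: real^'m). transpose M *v y)"
    unfolding bilinear_def
    by (auto intro!: linearI simp: matrix_vector_mult_def transpose_def vec_eq_iff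
        algebra_simps sum.distrib sum_distrib_left simp del: transpose_matrix_vector)
  then show ?thesis
    by (simp add: bilinear_conv_bounded_bilinear)
qed

text \<open>The product rule for the multiplier term; its part with \<open>J\<close> contributes the
  second derivatives of the constraints, turning Hessians of costs into Hessians of
  Lagrangians.\<close>

lemma equilibrium_map_strict_derivative:
  fixes owner :: "'n::finite \<Rightarrow> 'p" and F :: "(real^'n) \<times> (real^'d) \<Rightarrow> real^'m"
  assumes H: "\<And>\<nu>. has_strict_derivative (\<lambda>(x, w). grad (\<lambda>x'. f \<nu> (x', w)) x) (H \<nu>) (xb, wb)"
    and J: "has_strict_derivative (\<lambda>(x, w). jacobian (\<lambda>x'. F (x', w)) (at x)) J (xb, wb)"
    and F: "has_strict_derivative F F' (xb, wb)"
  shows "has_strict_derivative (equilibrium_map owner f F)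
    (\<lambda>((h, k), e). ((\<chi> i. H (owner i) (h, e) $ i) +
       (transpose (jacobian (\<lambda>x'. F (x', wb)) (at xb)) *v k + transpose (J (h, e)) *v yb), F' (h, e)))
    ((xb, yb), wb)"
proof -
  define P :: "((real^'n) \<times> (real^'m)) \<times> (real^'d) \<Rightarrow> (real^'n) \<times> (real^'d)" where
    "P q = (fst (fst q), snd q)" for q
  define Y :: "((real^'n) \<times> (real^'m)) \<times> (real^'d) \<Rightarrow> real^'m" where "Y q = snd (fst q)" for q
  let ?z = "((xb, yb), wb)"
  have P: "bounded_linear P"
    unfolding P_def by (intro bounded_linear_Pair bounded_linear_snd
        bounded_linear_compose[OF bounded_linear_fst bounded_linear_fst])
  have Y: "has_strict_derivative Y Y ?z"
    unfolding Y_def by (intro bounded_linear_imp_has_strict_derivative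
        bounded_linear_compose[OF bounded_linear_snd bounded_linear_fst])
  have Pz: "P ?z = (xb, wb)"
    by (simp add: P_def)
  note comp = has_strict_derivative_compose_linear[OF P, where z = ?z, unfolded Pz]
  have "has_strict_derivative (\<lambda>q. \<chi> i. (case P q of (x, w) \<Rightarrow> grad (\<lambda>x'. f (owner i) (x', w)) x) $ i)
      (\<lambda>d. \<chi> i. H (owner i) (P d) $ i) ?z"
    by (rule has_strict_derivative_vec) (simp add: has_strict_derivative_nth[OF comp[OF H]])
  moreover note has_strict_derivative_bilinear[OF bounded_bilinear_transpose_mult comp[OF J] Y]
  ultimately have "has_strict_derivative
      (\<lambda>q. ((\<chi> i. (case P q of (x, w) \<Rightarrow> grad (\<lambda>x'. f (owner i) (x', w)) x) $ i) +
          transpose (case P q of (x, w) \<Rightarrow> jacobian (\<lambda>x'. F (x', w)) (at x)) *v Y q, F (P q)))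
      (\<lambda>d. ((\<chi> i. H (owner i) (P d) $ i) +
        (transpose (case P ?z of (x, w) \<Rightarrow> jacobian (\<lambda>x'. F (x', w)) (at x)) *v Y d +
         transpose (J (P d)) *v Y ?z), F' (P d))) ?z"
    by (intro has_strict_derivative_Pair has_strict_derivative_add comp[OF F])
  then show ?thesis
    by (simp add: equilibrium_map_def P_def Y_def case_prod_unfold del: transpose_matrix_vector)
qed

theorem theorem3p3:
  fixes owner :: "'n::finite \<Rightarrow> 'p::finite"
    and E :: "'m::finite set"
    and f :: "'p \<Rightarrow> (real^'n) \<times> (real^'d::finite) \<Rightarrow> real"
    and F :: "(real^'n) \<times> (real^'d) \<Rightarrow> real^'m"
    and xb :: "real^'n" and yb :: "real^'m" and wb :: "real^'d"
    and W :: "((real^'n) \<times> (real^'d)) set"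
  defines "\<theta> \<equiv> (\<lambda>\<nu> x. f \<nu> (x, wb))"
    and "g \<equiv> (\<lambda>x. F (x, wb))"
  defines "G \<equiv> G_matrix owner \<theta> g xb yb"
    and "\<alpha> \<equiv> alpha_set E g xb yb"
    and "\<beta> \<equiv> beta_set E g xb yb"
  assumes sol: "(xb, yb) \<in> S_Lag owner E f F (wb, 0, 0)"
    and nbhd: "open W" "(xb, wb) \<in> W"
    and f_twice: "\<And>\<nu> x w. (x, w) \<in> W \<Longrightarrow> twice_differentiable_at (\<lambda>x'. f \<nu> (x', w)) x"
    and F_twice: "\<And>x w. (x, w) \<in> W \<Longrightarrow> twice_differentiable_at (\<lambda>x'. F (x', w)) x"
    and f_strict: "\<And>\<nu> z. z \<in> W \<Longrightarrow> strictly_differentiable_at (f \<nu>) z"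
    and F_strict: "\<And>z. z \<in> W \<Longrightarrow> strictly_differentiable_at F z"
    and grad_strict: "\<And>\<nu> z. z \<in> W \<Longrightarrow>
      strictly_differentiable_at (\<lambda>(x, w). grad (\<lambda>x'. f \<nu> (x', w)) x) z"
    and jac_strict: "\<And>z. z \<in> W \<Longrightarrow>
      strictly_differentiable_at (\<lambda>(x, w). jacobian (\<lambda>x'. F (x', w)) (at x)) z"
  shows "has_lipschitz_localization (S_Lag owner E f F) (wb, 0, 0) (xb, yb) \<longleftrightarrow>
    (\<forall>\<beta>p \<beta>0 \<beta>m. \<beta> = \<beta>p \<union> \<beta>0 \<union> \<beta>m \<and> \<beta>p \<inter> \<beta>0 = {} \<and> \<beta>p \<inter> \<beta>m = {} \<and> \<beta>0 \<inter> \<beta>m = {} \<longrightarrow>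
      (let \<alpha>p = \<alpha> \<union> \<beta>p in
       \<forall>w1 :: real^'n. \<forall>w2 :: real^'m.
         transpose G *v w1 = jacobian_transpose_on \<alpha>p g xb w2 + jacobian_transpose_on \<beta>0 g xb w2 \<and>
         (\<forall>i\<in>\<alpha>p. (jacobian g (at xb) *v w1) $ i = 0) \<and>
         (\<forall>i\<in>\<beta>0. (jacobian g (at xb) *v w1) $ i \<le> 0) \<and>
         (\<forall>i\<in>\<beta>0. w2 $ i \<ge> 0)
         \<longrightarrow> w1 = 0 \<and> (\<forall>i\<in>\<alpha>p \<union> \<beta>0. w2 $ i = 0)))"
proof -
  define A where "A = jacobian g (at xb)"
  define \<Theta> where "\<Theta> = equilibrium_map owner f F"
  define tb where "tb = yb + snd (\<Theta> ((xb, yb), wb))"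
  have "\<exists>D. has_strict_derivative (\<lambda>(x, w). grad (\<lambda>x'. f \<nu> (x', w)) x) D (xb, wb)" for \<nu>
    using strictly_differentiable_at_imp[OF grad_strict[OF nbhd(2)]] by metis
  then obtain H where H: "\<And>\<nu>. has_strict_derivative (\<lambda>(x, w). grad (\<lambda>x'. f \<nu> (x', w)) x) (H \<nu>) (xb, wb)"
    by metis
  obtain J where J: "has_strict_derivative (\<lambda>(x, w). jacobian (\<lambda>x'. F (x', w)) (at x)) J (xb, wb)"
    using strictly_differentiable_at_imp[OF jac_strict[OF nbhd(2)]] by blast
  obtain F' where F': "has_strict_derivative F F' (xb, wb)"
    using strictly_differentiable_at_imp[OF F_strict[OF nbhd(2)]] by blast
  define T where "T = (\<lambda>((h, k), e). ((\<chi> i. H (owner i) (h, e) $ i) +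
       (transpose A *v k + transpose (J (h, e)) *v yb), F' (h, e)))"
  have T: "has_strict_derivative \<Theta> T ((xb, yb), wb)"
    unfolding \<Theta>_def T_def A_def g_def by (rule equilibrium_map_strict_derivative[OF H J F'])
  have slice: "((\<lambda>x. q (x, wb)) has_derivative (\<lambda>h. D (h, 0))) (at xb)"
    if "has_strict_derivative q D (xb, wb)" for q :: "(real^'n) \<times> (real^'d) \<Rightarrow> 'x::real_normed_vector" and D
    by (rule has_derivative_compose[where g = q])
      (use has_strict_derivative_imp_has_derivative[OF that] in \<open>auto intro!: derivative_eq_intros\<close>)
  have F'_eq: "F' (h, 0) = A *v h" for h
    using jacobian_mult[OF slice[OF F']] by (simp add: A_def g_def)
  have G_eq: "(\<chi> i. H (owner i) (h, 0) $ i) + transpose (J (h, 0)) *v yb = G *v h" for h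
  proof -
    have "((\<lambda>x. (x, wb)) \<longlongrightarrow> (xb, wb)) (nhds xb)"
      by (intro tendsto_intros filterlim_ident)
    then have near: "\<forall>\<^sub>F x in nhds xb. (x, wb) \<in> W"
      using nbhd by (rule topological_tendstoD)
    have "hessian (\<lambda>x'. lagrangian \<theta> g \<nu> x' yb) xb *v h = H \<nu> (h, 0) + transpose (J (h, 0)) *v yb" for \<nu>
    proof -
      \<comment> \<open>Differentiating the gradient requires the formula for it on a neighborhood
        of \<open>xb\<close>, not only at \<open>xb\<close>; \<open>W\<close> provides one.\<close>
      have ev: "\<forall>\<^sub>F x in nhds xb. grad (\<theta> \<nu>) x + transpose (jacobian g (at x)) *v yb =
          grad (\<lambda>x'. lagrangian \<theta> g \<nu> x' yb) x"
        using near
      proof eventually_elim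
        case (elim x)
        show ?case
          using twice_differentiable_at_imp_differentiable[OF f_twice[OF elim, of \<nu>]]
            twice_differentiable_at_imp_differentiable[OF F_twice[OF elim]]
          unfolding lagrangian_def \<theta>_def g_def by (rule grad_add_inner[symmetric])
      qed
      have der: "((\<lambda>x. grad (\<theta> \<nu>) x + transpose (jacobian g (at x)) *v yb) has_derivative
          (\<lambda>h. H \<nu> (h, 0) + transpose (J (h, 0)) *v yb)) (at xb)"
        using has_derivative_add[OF slice[OF H] bounded_linear.has_derivative[OF
              bounded_bilinear.bounded_linear_left[OF bounded_bilinear_transpose_mult] slice[OF J]]]
        by (simp add: \<theta>_def g_def del: transpose_matrix_vector)
      have "(grad (\<lambda>x'. lagrangian \<theta> g \<nu> x' yb) has_derivative
          (\<lambda>h. H \<nu> (h, 0) + transpose (J (h, 0)) *v yb)) (at xb)"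
        by (rule has_derivative_transform_eventually[OF der])
          (use ev eventually_nhds_x_imp_x[OF ev] in \<open>simp_all add: eventually_at_filter eventually_mono\<close>)
      then show ?thesis
        unfolding hessian_def by (rule jacobian_mult)
    qed
    moreover have "(G *v h) $ i = (hessian (\<lambda>x'. lagrangian \<theta> g (owner i) x' yb) xb *v h) $ i" for i
      by (simp add: G_def G_matrix_def matrix_vector_mult_def)
    ultimately show ?thesis
      by (simp add: vec_eq_iff del: transpose_matrix_vector)
  qed
  have snd_\<Theta>: "snd (\<Theta> ((xb, yb), wb)) = g xb"
    by (simp add: \<Theta>_def equilibrium_map_def g_def)
  have base: "fst (\<Theta> ((xb, yb), wb)) = 0" "polar_proj E tb = yb"
    using sol unfolding mem_S_Lag_iff by (simp_all add: \<Theta>_def tb_def)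
  have comp: "yb $ i = max (yb $ i + g xb $ i) 0" if "i \<notin> E" for i
    using base(2) that unfolding tb_def snd_\<Theta> by (metis polar_proj_nth vector_add_component)
  \<comment> \<open>By complementarity, \<open>tb $ i\<close> off \<open>E\<close> equals the
    multiplier if positive and the constraint value if negative, and it vanishes only if both
    do.\<close>
  have \<alpha>: "\<alpha> = {i. i \<in> E \<or> 0 < tb $ i}" and \<beta>: "\<beta> = {i. i \<notin> E \<and> tb $ i = 0}"
    using comp unfolding \<alpha>_def \<beta>_def alpha_set_def beta_set_def tb_def snd_\<Theta> by force+
  have disj: "\<alpha> \<inter> \<beta> = {}"
    by (auto simp: \<alpha> \<beta>)
  interpret parametric_complementarity E \<Theta> T xb yb wb tb \<alpha> \<beta>
    using T base by unfold_locales (auto simp: \<alpha> \<beta> tb_def)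
  have S: "S_Lag owner E f F = solutions"
    by (auto simp: fun_eq_iff solutions_def mem_S_Lag_iff[of _ _ owner E f F, folded \<Theta>_def])
  \<comment> \<open>With the parameter direction 0, \<open>T\<close> reduces to \<open>G\<close> and
    \<open>A\<close>, and its kernel condition is that of the transposed coderivative
    matrix.\<close>
  have "T ((h, d * k), 0) = (0, (1 - d) * k) \<longleftrightarrow>
      G *v h + transpose A *v (d * k) = 0 \<and> A *v h = (1 - d) * k" for h d k
    by (simp add: T_def F'_eq add_ac del: transpose_matrix_vector flip: G_eq)
  then have "has_lipschitz_localization (S_Lag owner E f F) (wb, 0, 0) (xb, yb) \<longleftrightarrow>
      (\<forall>d\<in>weights \<alpha> \<beta>. det (coderivative_matrix G A d) \<noteq> 0)"
    unfolding S localization_iff_nonsingular coderivative_matrix_nonsingular_iff_transpose by simp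
  also have "\<dots> \<longleftrightarrow> partition_criterion G A \<alpha> \<beta>"
    by (rule partition_criterion_iff_nonsingular[OF disj, symmetric])
  finally show ?thesis
    unfolding partition_criterion_def Let_def jacobian_transpose_on_def A_def .
qed

end
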